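(* Let $G$ be a discrete group and $\sigma\in Z^2(G,\mathbb{T})$. Consider the following conditions: (i) $G$ has the $\ell^2$-spectral radius property and the free semigroup property. (ii) For every finite subset $F$ of $G$, there exists $g\in G$ such that $gF$ is semifree and $gF$ has the $\ell^2$-spectral radius property. (iii) For every finite subset $F$ of $G$, there exists $g\in G$ such that $gF$ has the SR-property. (iv) For every finite subset $F$ of $G$, there exists $g\in G$ such that $gF$ has the SR-property w.r.t. $\sigma$. (v) $C_r^*(G,\sigma)$ has stable rank one. Then (i) $\Rightarrow$ (ii) $\Rightarrow$ (iii) $\Rightarrow$ (iv) $\Rightarrow$ (v).
   Context: For a discrete group $G$ with identity $e$, $Z^2(G,\mathbb{T})$ is the set of normalized 2-cocycles, i.e. maps $\sigma:G\times G\to\mathbb{T}$ with $\sigma(g,e)=\sigma(e,g)=1$ and $\sigma(g,h)\sigma(gh,k)=\sigma(h,k)\sigma(g,hk)$ for all $g,h,k$. With $(\lambda_\sigma(g)\xi)(h)=\sigma(g,g^{-1}h)\xi(g^{-1}h)$ on $\ell^2(G)$, $C_r^*(G,\sigma)$ is the C$^*$-algebra generated by $\lambda_\sigma(G)$. It has stable rank one if its invertible elements are dense. $C_c(G)$ is the space of finitely supported functions $f:G\to\mathbb{C}$, and $\Lambda_\sigma(f)=\sum_{g\in G}f(g)\lambda_\sigma(g)$ for $f\in C_c(G)$; $\Lambda(f)$ is $\Lambda_\sigma(f)$ for $\sigma=1$. For a bounded operator $a$ on $\ell^2(G)$, $r(a)$ is its spectral radius and $r_2(a)=\limsup_{n\to\infty}\|a^n\delta_e\|_2^{1/n}$.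 A finite subset $S$ of $G$ has the $\ell^2$-spectral radius property if $r_2(\Lambda(f))=r(\Lambda(f))$ for every $f\in C_c(G)$ with $\mathrm{supp}(f)\subset S$; $G$ has the $\ell^2$-spectral radius property if all its finite subsets do. A finite subset $S$ of $G$ is semifree if the subsemigroup generated by $S$ in $G$ is free over $S$. $G$ has the free semigroup property if for every finite $F\subset G$ there is $g\in G$ such that $gF$ is semifree. A finite subset $S$ of $G$ has the SR-property w.r.t. $\sigma$ if $r(\Lambda_\sigma(f))\le\|f\|_2$ for every $f\in C_c(G)$ with $\mathrm{supp}(f)\subset S$; for $\sigma=1$ one says that $S$ has the SR-property. *)

theory Defs
  imports "HOL-Analysis.Analysis"
begin

section \<open>The Hilbert space of square-summable complex functions\<close>

definition square_summable :: "('g \<Rightarrow> complex) \<Rightarrow> bool" where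
  "square_summable f \<longleftrightarrow> (\<lambda>x. (cmod (f x))\<^sup>2) summable_on UNIV"

lemma square_summable_sum_le:
  assumes "square_summable f" "finite F"
  shows "L2_set (\<lambda>x. cmod (f x)) F \<le> sqrt (\<Sum>\<^sub>\<infinity>x. (cmod (f x))\<^sup>2)"
  unfolding L2_set_def
  using assms by (auto simp: square_summable_def intro!: finite_sum_le_infsum)

lemma square_summableI:
  assumes "\<And>F. finite F \<Longrightarrow> L2_set (\<lambda>x. cmod (f x)) F \<le> b"
  shows "square_summable f" and "sqrt (\<Sum>\<^sub>\<infinity>x. (cmod (f x))\<^sup>2) \<le> b"
proof -
  have b: "b \<ge> 0" using assms[of "{}"] by simp
  have le: "(\<Sum>x\<in>F. (cmod (f x))\<^sup>2) \<le> b\<^sup>2" if "finite F" for F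
    using assms[OF that] by (simp add: L2_set_def real_sqrt_le_iff' sum_nonneg b)
  then show s: "square_summable f"
    unfolding square_summable_def
    by (intro nonneg_bdd_above_summable_on) (auto simp: bdd_above_def)
  have "(\<Sum>\<^sub>\<infinity>x. (cmod (f x))\<^sup>2) \<le> b\<^sup>2"
    using s le unfolding square_summable_def by (intro infsum_le_finite_sums) auto
  then show "sqrt (\<Sum>\<^sub>\<infinity>x. (cmod (f x))\<^sup>2) \<le> b"
    using b by (simp add: real_le_lsqrt)
qed

lemma square_summable_add:
  assumes "square_summable f" "square_summable g"
  shows "square_summable (\<lambda>x. f x + g x)"
    and "sqrt (\<Sum>\<^sub>\<infinity>x. (cmod (f x + g x))\<^sup>2)
           \<le> sqrt (\<Sum>\<^sub>\<infinity>x. (cmod (f x))\<^sup>2) + sqrt (\<Sum>\<^sub>\<infinity>x. (cmod (g x))\<^sup>2)"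
proof -
  have *: "L2_set (\<lambda>x. cmod (f x + g x)) F
           \<le> sqrt (\<Sum>\<^sub>\<infinity>x. (cmod (f x))\<^sup>2) + sqrt (\<Sum>\<^sub>\<infinity>x. (cmod (g x))\<^sup>2)" if "finite F" for F
  proof -
    have "L2_set (\<lambda>x. cmod (f x + g x)) F \<le> L2_set (\<lambda>x. cmod (f x) + cmod (g x)) F"
      by (intro L2_set_mono norm_triangle_ineq) auto
    also have "\<dots> \<le> L2_set (\<lambda>x. cmod (f x)) F + L2_set (\<lambda>x. cmod (g x)) F"
      by (rule L2_set_triangle_ineq)
    also have "\<dots> \<le> sqrt (\<Sum>\<^sub>\<infinity>x. (cmod (f x))\<^sup>2) + sqrt (\<Sum>\<^sub>\<infinity>x. (cmod (g x))\<^sup>2)"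
      using assms that by (intro add_mono square_summable_sum_le)
    finally show ?thesis .
  qed
  show "square_summable (\<lambda>x. f x + g x)"
    by (rule square_summableI(1)[OF *])
  show "sqrt (\<Sum>\<^sub>\<infinity>x. (cmod (f x + g x))\<^sup>2)
           \<le> sqrt (\<Sum>\<^sub>\<infinity>x. (cmod (f x))\<^sup>2) + sqrt (\<Sum>\<^sub>\<infinity>x. (cmod (g x))\<^sup>2)"
    by (rule square_summableI(2)[OF *])
qed

lemma square_summable_mult:
  "square_summable f \<Longrightarrow> square_summable (\<lambda>x. c * f x)"
  unfolding square_summable_def norm_mult power_mult_distrib
  by (rule summable_on_cmult_right)

lemma square_summable_finite:
  assumes "finite {x. f x \<noteq> 0}" shows "square_summable f"
proof -
  have "(\<lambda>x. (cmod (f x))\<^sup>2) summable_on {x. f x \<noteq> 0}"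
    using assms by (rule summable_on_finite)
  also have "?this \<longleftrightarrow> (\<lambda>x. (cmod (f x))\<^sup>2) summable_on UNIV"
    by (rule summable_on_cong_neutral) auto
  finally show ?thesis
    unfolding square_summable_def .
qed

typedef 'g ell2 = "{f :: 'g \<Rightarrow> complex. square_summable f}"
  by (rule exI[of _ "\<lambda>_. 0"]) (simp add: square_summable_finite)

setup_lifting type_definition_ell2

instantiation ell2 :: (type) real_normed_vector
begin

lift_definition zero_ell2 :: "'a ell2" is "\<lambda>_. 0"
  by (simp add: square_summable_finite)

lift_definition plus_ell2 :: "'a ell2 \<Rightarrow> 'a ell2 \<Rightarrow> 'a ell2" is "\<lambda>f g x. f x + g x"
  by (rule square_summable_add(1))

lift_definition uminus_ell2 :: "'a ell2 \<Rightarrow> 'a ell2" is "\<lambda>f x. - f x"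
  by (simp add: square_summable_def)

lift_definition minus_ell2 :: "'a ell2 \<Rightarrow> 'a ell2 \<Rightarrow> 'a ell2" is "\<lambda>f g x. f x - g x"
  subgoal for f g
    using square_summable_add(1)[of f "\<lambda>x. - 1 * g x"] square_summable_mult[of g "- 1"] by simp
  done

lift_definition scaleR_ell2 :: "real \<Rightarrow> 'a ell2 \<Rightarrow> 'a ell2" is "\<lambda>r f x. complex_of_real r * f x"
  by (rule square_summable_mult)

lift_definition norm_ell2 :: "'a ell2 \<Rightarrow> real" is "\<lambda>f. sqrt (\<Sum>\<^sub>\<infinity>x. (cmod (f x))\<^sup>2)" .

definition sgn_ell2 :: "'a ell2 \<Rightarrow> 'a ell2" where
  "sgn_ell2 \<xi> = inverse (norm \<xi>) *\<^sub>R \<xi>"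

definition dist_ell2 :: "'a ell2 \<Rightarrow> 'a ell2 \<Rightarrow> real" where
  "dist_ell2 \<xi> \<eta> = norm (\<xi> - \<eta>)"

definition uniformity_ell2 :: "('a ell2 \<times> 'a ell2) filter" where
  "uniformity_ell2 = (INF e\<in>{0<..}. principal {(x, y). dist x y < e})"

definition open_ell2 :: "'a ell2 set \<Rightarrow> bool" where
  "open_ell2 U \<longleftrightarrow> (\<forall>x\<in>U. \<forall>\<^sub>F (x', y) in uniformity. x' = x \<longrightarrow> y \<in> U)"

instance
proof
  fix \<xi> \<eta> \<zeta> :: "'a ell2" and a b :: real
  show "\<xi> + \<eta> + \<zeta> = \<xi> + (\<eta> + \<zeta>)" "\<xi> + \<eta> = \<eta> + \<xi>" "0 + \<xi> = \<xi>" "- \<xi> + \<xi> = 0" "\<xi> - \<eta> = \<xi> + - \<eta>"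
    "a *\<^sub>R (\<xi> + \<eta>) = a *\<^sub>R \<xi> + a *\<^sub>R \<eta>" "(a + b) *\<^sub>R \<xi> = a *\<^sub>R \<xi> + b *\<^sub>R \<xi>"
    "a *\<^sub>R b *\<^sub>R \<xi> = (a * b) *\<^sub>R \<xi>" "1 *\<^sub>R \<xi> = \<xi>"
    by (transfer; simp add: fun_eq_iff algebra_simps; fail)+
  show "dist \<xi> \<eta> = norm (\<xi> - \<eta>)" "sgn \<xi> = inverse (norm \<xi>) *\<^sub>R \<xi>"
    "(uniformity :: ('a ell2 \<times> 'a ell2) filter) = (INF e\<in>{0<..}. principal {(x, y). dist x y < e})"
    by (simp_all add: dist_ell2_def sgn_ell2_def uniformity_ell2_def)
  show "open U \<longleftrightarrow> (\<forall>x\<in>U. \<forall>\<^sub>F (x', y) in uniformity. x' = x \<longrightarrow> y \<in> U)" for U :: "'a ell2 set"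
    by (rule open_ell2_def)
  show "norm (\<xi> + \<eta>) \<le> norm \<xi> + norm \<eta>"
    by transfer (rule square_summable_add(2))
  show "norm (a *\<^sub>R \<xi>) = \<bar>a\<bar> * norm \<xi>"
    by transfer (simp add: norm_mult power_mult_distrib infsum_cmult_right' real_sqrt_mult)
  show "norm \<xi> = 0 \<longleftrightarrow> \<xi> = 0"
  proof transfer
    fix f :: "'a \<Rightarrow> complex" assume f: "square_summable f"
    show "sqrt (\<Sum>\<^sub>\<infinity>x. (cmod (f x))\<^sup>2) = 0 \<longleftrightarrow> f = (\<lambda>_. 0)"
    proof
      assume "sqrt (\<Sum>\<^sub>\<infinity>x. (cmod (f x))\<^sup>2) = 0"
      then have "cmod (f x) \<le> 0" for x
        using square_summable_sum_le[OF f, of "{x}"] by (simp add: L2_set_def)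
      then show "f = (\<lambda>_. 0)" by auto
    qed simp
  qed
qed

end

lift_definition scaleC_ell2 :: "complex \<Rightarrow> 'g ell2 \<Rightarrow> 'g ell2" is "\<lambda>c f x. c * f x"
  by (rule square_summable_mult)

definition cinner :: "'g ell2 \<Rightarrow> 'g ell2 \<Rightarrow> complex" where
  "cinner \<xi> \<eta> = (\<Sum>\<^sub>\<infinity>x. Rep_ell2 \<xi> x * cnj (Rep_ell2 \<eta> x))"

lift_definition delta :: "'g \<Rightarrow> 'g ell2" is "\<lambda>g x. if x = g then 1 else 0"
  by (rule square_summable_finite) simp

lemma delta_nonzero: "delta g \<noteq> 0"
  by transfer (auto simp: fun_eq_iff)


section \<open>Bounded complex-linear operators\<close>

typedef 'g bop = "{T :: 'g ell2 \<Rightarrow> 'g ell2.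
    bounded_linear T \<and> (\<forall>c \<xi>. T (scaleC_ell2 c \<xi>) = scaleC_ell2 c (T \<xi>))}"
  morphisms bop_apply Bop
  by (rule exI[of _ "\<lambda>_. 0"]) (auto, transfer, simp)

setup_lifting type_definition_bop

lemma scaleC_ell2_add: "scaleC_ell2 c (\<xi> + \<eta>) = scaleC_ell2 c \<xi> + scaleC_ell2 c \<eta>"
  by transfer (simp add: algebra_simps)

lemma scaleC_ell2_minus: "scaleC_ell2 c (- \<xi>) = - scaleC_ell2 c \<xi>"
  by transfer simp

lemma scaleC_ell2_diff: "scaleC_ell2 c (\<xi> - \<eta>) = scaleC_ell2 c \<xi> - scaleC_ell2 c \<eta>"
  by transfer (simp add: algebra_simps)

lemma scaleC_ell2_zero: "scaleC_ell2 c 0 = 0"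
  by transfer simp

lemma scaleC_ell2_scaleC: "scaleC_ell2 c (scaleC_ell2 d \<xi>) = scaleC_ell2 (c * d) \<xi>"
  by transfer (simp add: mult.assoc)

lemma scaleR_scaleC_ell2: "r *\<^sub>R \<xi> = scaleC_ell2 (complex_of_real r) \<xi>"
  by transfer simp

lemma norm_scaleC_ell2: "norm (scaleC_ell2 c \<xi>) = cmod c * norm \<xi>"
  by transfer (simp add: norm_mult power_mult_distrib infsum_cmult_right' real_sqrt_mult)

lemma bounded_linear_scaleC_ell2: "bounded_linear (scaleC_ell2 c)"
  by (rule bounded_linear_intro[of _ "cmod c"])
    (simp_all add: scaleC_ell2_add norm_scaleC_ell2 scaleR_scaleC_ell2 scaleC_ell2_scaleC mult.commute)

instantiation bop :: (type) real_normed_algebra_1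
begin

lift_definition zero_bop :: "'a bop" is "\<lambda>_. 0"
  by (simp add: scaleC_ell2_zero)

lift_definition one_bop :: "'a bop" is "\<lambda>\<xi>. \<xi>"
  by simp

lift_definition plus_bop :: "'a bop \<Rightarrow> 'a bop \<Rightarrow> 'a bop" is "\<lambda>S T \<xi>. S \<xi> + T \<xi>"
  by (auto simp: scaleC_ell2_add intro: bounded_linear_add)

lift_definition uminus_bop :: "'a bop \<Rightarrow> 'a bop" is "\<lambda>S \<xi>. - S \<xi>"
  by (auto simp: scaleC_ell2_minus intro: bounded_linear_minus)

lift_definition minus_bop :: "'a bop \<Rightarrow> 'a bop \<Rightarrow> 'a bop" is "\<lambda>S T \<xi>. S \<xi> - T \<xi>"
  by (auto simp: scaleC_ell2_diff intro: bounded_linear_sub)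

lift_definition times_bop :: "'a bop \<Rightarrow> 'a bop \<Rightarrow> 'a bop" is "\<lambda>S T \<xi>. S (T \<xi>)"
  by (auto intro: bounded_linear_compose)

lift_definition scaleR_bop :: "real \<Rightarrow> 'a bop \<Rightarrow> 'a bop" is "\<lambda>r S \<xi>. r *\<^sub>R S \<xi>"
  by (auto simp: scaleR_scaleC_ell2 scaleC_ell2_scaleC mult.commute
      intro: bounded_linear_compose[OF bounded_linear_scaleC_ell2])

lift_definition norm_bop :: "'a bop \<Rightarrow> real" is onorm .

definition sgn_bop :: "'a bop \<Rightarrow> 'a bop" where
  "sgn_bop a = inverse (norm a) *\<^sub>R a"

definition dist_bop :: "'a bop \<Rightarrow> 'a bop \<Rightarrow> real" where
  "dist_bop a b = norm (a - b)"

definition uniformity_bop :: "('a bop \<times> 'a bop) filter" where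
  "uniformity_bop = (INF e\<in>{0<..}. principal {(x, y). dist x y < e})"

definition open_bop :: "'a bop set \<Rightarrow> bool" where
  "open_bop U \<longleftrightarrow> (\<forall>x\<in>U. \<forall>\<^sub>F (x', y) in uniformity. x' = x \<longrightarrow> y \<in> U)"

instance
proof
  fix a b c :: "'a bop" and r s :: real
  show "a + b + c = a + (b + c)" "a + b = b + a" "0 + a = a" "- a + a = 0" "a - b = a + - b"
    "r *\<^sub>R (a + b) = r *\<^sub>R a + r *\<^sub>R b" "(r + s) *\<^sub>R a = r *\<^sub>R a + s *\<^sub>R a"
    "r *\<^sub>R s *\<^sub>R a = (r * s) *\<^sub>R a" "1 *\<^sub>R a = a" "a * b * c = a * (b * c)"
    "(a + b) * c = a * c + b * c" "1 * a = a" "a * 1 = a" "r *\<^sub>R a * b = r *\<^sub>R (a * b)"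
    by (transfer; simp add: fun_eq_iff algebra_simps; fail)+
  show "a * (b + c) = a * b + a * c" "a * r *\<^sub>R b = r *\<^sub>R (a * b)"
    by (transfer; simp add: fun_eq_iff linear_simps; fail)+
  show "dist a b = norm (a - b)" "sgn a = inverse (norm a) *\<^sub>R a"
    "(uniformity :: ('a bop \<times> 'a bop) filter) = (INF e\<in>{0<..}. principal {(x, y). dist x y < e})"
    by (simp_all add: dist_bop_def sgn_bop_def uniformity_bop_def)
  show "open U \<longleftrightarrow> (\<forall>x\<in>U. \<forall>\<^sub>F (x', y) in uniformity. x' = x \<longrightarrow> y \<in> U)" for U :: "'a bop set"
    by (rule open_bop_def)
  show "norm (a + b) \<le> norm a + norm b"
    by transfer (auto intro: onorm_triangle)
  show "norm (r *\<^sub>R a) = \<bar>r\<bar> * norm a"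
    by transfer (auto intro: onorm_scaleR)
  show "norm a = 0 \<longleftrightarrow> a = 0"
    by transfer (auto simp: onorm_eq_0)
  show "norm (a * b) \<le> norm a * norm b"
    by transfer (metis (no_types, lifting) onorm_compose comp_def ext)
  show "norm (1 :: 'a bop) = 1"
  proof transfer
    show "onorm (\<lambda>\<xi> :: 'a ell2. \<xi>) = 1"
      using le_onorm[of "\<lambda>\<xi> :: 'a ell2. \<xi>" "delta undefined"] onorm_id_le[where 'a = "'a ell2"]
      by (intro antisym) (simp_all add: delta_nonzero)
  qed
  show "(0 :: 'a bop) \<noteq> 1"
    by transfer (metis delta_nonzero)
qed

end

lift_definition scaleC_bop :: "complex \<Rightarrow> 'g bop \<Rightarrow> 'g bop" is "\<lambda>c S \<xi>. scaleC_ell2 c (S \<xi>)"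
  by (auto simp: scaleC_ell2_scaleC mult.commute
      intro: bounded_linear_compose[OF bounded_linear_scaleC_ell2])

text \<open>The inverse is sought inside \<open>A\<close>; for \<open>A = UNIV\<close> this is invertibility in the
  algebra of all bounded operators.\<close>

definition invertible_elements :: "'g bop set \<Rightarrow> 'g bop set" where
  "invertible_elements A = {a \<in> A. \<exists>b\<in>A. a * b = 1 \<and> b * a = 1}"

definition spectrum :: "'g bop \<Rightarrow> complex set" where
  "spectrum a = {z. scaleC_bop z 1 - a \<notin> invertible_elements UNIV}"

definition spectral_radius :: "'g bop \<Rightarrow> real" where
  "spectral_radius a = (SUP z\<in>spectrum a. cmod z)"

text \<open>Groups are written additively, as instances of the class of not necessarily commutative
  additive groups: the product $gh$ is \<open>g + h\<close>, the identity $e$ is \<open>0\<close>, $g^{-1}h$ is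
  \<open>- g + h\<close>, and $gF$ is \<open>(+) g ` F\<close>.\<close>

definition r2 :: "'g::group_add bop \<Rightarrow> ereal" where
  "r2 a = limsup (\<lambda>n. ereal (root n (norm (bop_apply (a ^ n) (delta 0)))))"

definition is_adjoint :: "'g bop \<Rightarrow> 'g bop \<Rightarrow> bool" where
  "is_adjoint a b \<longleftrightarrow> (\<forall>\<xi> \<eta>. cinner (bop_apply a \<xi>) \<eta> = cinner \<xi> (bop_apply b \<eta>))"

definition cstar_subalgebra :: "'g bop set \<Rightarrow> bool" where
  "cstar_subalgebra A \<longleftrightarrow> closed A \<and> 0 \<in> A \<and>
     (\<forall>a\<in>A. \<forall>b\<in>A. a + b \<in> A \<and> a * b \<in> A) \<and>
     (\<forall>c. \<forall>a\<in>A. scaleC_bop c a \<in> A) \<and>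
     (\<forall>a\<in>A. \<forall>b. is_adjoint a b \<longrightarrow> b \<in> A)"

definition cstar_generated :: "'g bop set \<Rightarrow> 'g bop set" where
  "cstar_generated X = \<Inter>{A. cstar_subalgebra A \<and> X \<subseteq> A}"

definition stable_rank_one :: "'g bop set \<Rightarrow> bool" where
  "stable_rank_one A \<longleftrightarrow> A \<subseteq> closure (invertible_elements A)"


section \<open>Twisted group algebras\<close>

definition normalized_cocycle :: "('g::group_add \<Rightarrow> 'g \<Rightarrow> complex) \<Rightarrow> bool" where
  "normalized_cocycle \<sigma> \<longleftrightarrow>
     (\<forall>g h. cmod (\<sigma> g h) = 1) \<and>
     (\<forall>g. \<sigma> g 0 = 1 \<and> \<sigma> 0 g = 1) \<and>
     (\<forall>g h k. \<sigma> g h * \<sigma> (g + h) k = \<sigma> h k * \<sigma> g (h + k))"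

definition twisted_shift :: "('g::group_add \<Rightarrow> 'g \<Rightarrow> complex) \<Rightarrow> 'g \<Rightarrow> ('g \<Rightarrow> complex) \<Rightarrow> 'g \<Rightarrow> complex" where
  "twisted_shift \<sigma> g \<xi> = (\<lambda>h. \<sigma> g (- g + h) * \<xi> (- g + h))"

text \<open>Both abstraction functions are applied to values in their domain whenever \<open>\<sigma>\<close> takes
  values in the unit circle; see \<open>lambda_apply\<close> below.\<close>

definition lambda :: "('g::group_add \<Rightarrow> 'g \<Rightarrow> complex) \<Rightarrow> 'g \<Rightarrow> 'g bop" where
  "lambda \<sigma> g = Bop (\<lambda>\<xi>. Abs_ell2 (twisted_shift \<sigma> g (Rep_ell2 \<xi>)))"

lemma twisted_shift_isometric:
  fixes \<sigma> :: "'g::group_add \<Rightarrow> 'g \<Rightarrow> complex"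
  assumes "\<And>g h. cmod (\<sigma> g h) = 1"
  shows "square_summable (twisted_shift \<sigma> g f) \<longleftrightarrow> square_summable f"
    and "(\<Sum>\<^sub>\<infinity>x. (cmod (twisted_shift \<sigma> g f x))\<^sup>2) = (\<Sum>\<^sub>\<infinity>x. (cmod (f x))\<^sup>2)"
proof -
  have bij: "bij_betw (\<lambda>h. - g + h) UNIV UNIV"
    by (rule bij_betw_byWitness[of _ "\<lambda>h. g + h"]) (auto simp: add.assoc[symmetric])
  show "square_summable (twisted_shift \<sigma> g f) \<longleftrightarrow> square_summable f"
    using summable_on_reindex_bij_betw[OF bij, of "\<lambda>x. (cmod (f x))\<^sup>2"]
    by (simp add: square_summable_def twisted_shift_def norm_mult assms)
  show "(\<Sum>\<^sub>\<infinity>x. (cmod (twisted_shift \<sigma> g f x))\<^sup>2) = (\<Sum>\<^sub>\<infinity>x. (cmod (f x))\<^sup>2)"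
    using infsum_reindex_bij_betw[OF bij, of "\<lambda>x. (cmod (f x))\<^sup>2"]
    by (simp add: twisted_shift_def norm_mult assms)
qed

lemma lambda_apply:
  fixes \<sigma> :: "'g::group_add \<Rightarrow> 'g \<Rightarrow> complex"
  assumes "\<And>g h. cmod (\<sigma> g h) = 1"
  shows "Rep_ell2 (bop_apply (lambda \<sigma> g) \<xi>) h = \<sigma> g (- g + h) * Rep_ell2 \<xi> (- g + h)"
proof -
  let ?T = "\<lambda>\<xi>. Abs_ell2 (twisted_shift \<sigma> g (Rep_ell2 \<xi>))"
  have rep: "Rep_ell2 (?T \<eta>) = twisted_shift \<sigma> g (Rep_ell2 \<eta>)" for \<eta>
    using Rep_ell2[of \<eta>] by (simp add: Abs_ell2_inverse twisted_shift_isometric(1)[OF assms])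
  have "bounded_linear ?T"
  proof (rule bounded_linear_intro[of _ 1])
    show "?T (\<eta> + \<zeta>) = ?T \<eta> + ?T \<zeta>" for \<eta> \<zeta>
      by (simp only: Rep_ell2_inject[symmetric] rep)
        (simp only: plus_ell2.rep_eq rep, simp add: twisted_shift_def algebra_simps)
    show "?T (r *\<^sub>R \<eta>) = r *\<^sub>R ?T \<eta>" for r \<eta>
      by (simp only: Rep_ell2_inject[symmetric] rep)
        (simp only: scaleR_ell2.rep_eq scaleC_ell2.rep_eq rep, simp add: twisted_shift_def mult_ac)
    show "norm (?T \<eta>) \<le> norm \<eta> * 1" for \<eta>
      by (simp add: norm_ell2.rep_eq rep twisted_shift_isometric(2)[OF assms])
  qed
  moreover have "?T (scaleC_ell2 c \<eta>) = scaleC_ell2 c (?T \<eta>)" for c \<eta>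
    by (simp only: Rep_ell2_inject[symmetric] rep)
      (simp only: scaleR_ell2.rep_eq scaleC_ell2.rep_eq rep, simp add: twisted_shift_def mult_ac)
  ultimately have "bop_apply (lambda \<sigma> g) = ?T"
    unfolding lambda_def by (intro Bop_inverse) auto
  then show ?thesis
    by (simp add: rep) (simp add: twisted_shift_def)
qed

definition reduced_cstar :: "('g::group_add \<Rightarrow> 'g \<Rightarrow> complex) \<Rightarrow> 'g bop set" where
  "reduced_cstar \<sigma> = cstar_generated (range (lambda \<sigma>))"

definition supp :: "('g \<Rightarrow> complex) \<Rightarrow> 'g set" where
  "supp f = {g. f g \<noteq> 0}"

definition Cc :: "('g \<Rightarrow> complex) set" where
  "Cc = {f. finite (supp f)}"

definition Lambda :: "('g::group_add \<Rightarrow> 'g \<Rightarrow> complex) \<Rightarrow> ('g \<Rightarrow> complex) \<Rightarrow> 'g bop" where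
  "Lambda \<sigma> f = (\<Sum>g\<in>supp f. scaleC_bop (f g) (lambda \<sigma> g))"

definition norm2 :: "('g \<Rightarrow> complex) \<Rightarrow> real" where
  "norm2 f = L2_set (\<lambda>g. cmod (f g)) (supp f)"

abbreviation trivial_cocycle :: "'g::group_add \<Rightarrow> 'g \<Rightarrow> complex" where
  "trivial_cocycle \<equiv> (\<lambda>_ _. 1)"


section \<open>Properties of finite subsets and of groups\<close>

definition l2_spectral_radius_property :: "'g::group_add set \<Rightarrow> bool" where
  "l2_spectral_radius_property S \<longleftrightarrow> finite S \<and>
     (\<forall>f\<in>Cc. supp f \<subseteq> S \<longrightarrow>
        r2 (Lambda trivial_cocycle f) = ereal (spectral_radius (Lambda trivial_cocycle f)))"

definition l2_spectral_radius_group :: "'g::group_add itself \<Rightarrow> bool" where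
  "l2_spectral_radius_group _ \<longleftrightarrow> (\<forall>S::'g set. finite S \<longrightarrow> l2_spectral_radius_property S)"

inductive_set subsemigroup_generated :: "'g::semigroup_add set \<Rightarrow> 'g set" for S where
  base: "s \<in> S \<Longrightarrow> s \<in> subsemigroup_generated S"
| mult: "a \<in> subsemigroup_generated S \<Longrightarrow> b \<in> subsemigroup_generated S
          \<Longrightarrow> a + b \<in> subsemigroup_generated S"

text \<open>The free semigroup over \<open>S\<close> consists of the nonempty words in \<open>S\<close> under concatenation; the
  canonical homomorphism extending the inclusion of \<open>S\<close> multiplies out a word (\<open>sum_list\<close> in
  additive notation), and it has to be an isomorphism onto the generated subsemigroup.\<close>

definition semifree :: "'g::group_add set \<Rightarrow> bool" where
  "semifree S \<longleftrightarrow> finite S \<and> bij_betw sum_list (lists S - {[]}) (subsemigroup_generated S)"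

definition free_semigroup_property :: "'g::group_add itself \<Rightarrow> bool" where
  "free_semigroup_property _ \<longleftrightarrow> (\<forall>F::'g set. finite F \<longrightarrow> (\<exists>g. semifree ((+) g ` F)))"

definition SR_property_wrt :: "('g::group_add \<Rightarrow> 'g \<Rightarrow> complex) \<Rightarrow> 'g set \<Rightarrow> bool" where
  "SR_property_wrt \<sigma> S \<longleftrightarrow> finite S \<and>
     (\<forall>f\<in>Cc. supp f \<subseteq> S \<longrightarrow> spectral_radius (Lambda \<sigma> f) \<le> norm2 f)"

abbreviation SR_property :: "'g::group_add set \<Rightarrow> bool" where
  "SR_property \<equiv> SR_property_wrt trivial_cocycle"

end

theory Submission
  imports Defs "HOL-Computational_Algebra.Fundamental_Theorem_Algebra"
begin

text \<open>
  The implication (i) \<open>\<Longrightarrow>\<close> (ii) is immediate. For (ii) \<open>\<Longrightarrow>\<close> (iii), distinct words over a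
  semifree set have distinct values, so that convolution powers of \<open>f\<close> never cancel and
  \<open>\<parallel>\<Lambda>(f)\<^sup>n\<delta>\<^sub>e\<parallel> = \<parallel>f\<parallel>\<^sub>2\<^sup>n\<close> (lemma \<open>norm_Lambda_power_semifree\<close>); hence \<open>r\<^sub>2(\<Lambda>(f)) = \<parallel>f\<parallel>\<^sub>2\<close>. For
  (iii) \<open>\<Longrightarrow>\<close> (iv), the pointwise estimate \<open>\<bar>\<Lambda>\<^sub>\<sigma>(f)\<xi>\<bar> \<le> \<Lambda>(\<bar>f\<bar>)\<bar>\<xi>\<bar>\<close> iterates to a comparison of the
  norms of all powers, and the spectral radius formula turns it into a comparison of spectral
  radii (lemma \<open>spectral_radius_le_if_powers_le\<close>).

  The implication (iv) \<open>\<Longrightarrow>\<close> (v) has two steps. Write \<open>A\<close> for the reduced algebra. First, every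
  \<open>b \<in> A\<close> has distance at most \<open>\<parallel>b\<delta>\<^sub>e\<parallel>\<close> from the invertible elements (lemma \<open>near_units_if_SR\<close>):
  approximate \<open>b\<close> by some \<open>\<Lambda>\<^sub>\<sigma>(f)\<close>, translate the support of \<open>f\<close> to a set with the SR-property by
  some \<open>g\<close>, and note that
  \<open>\<lambda>\<^sub>\<sigma>(g)\<Lambda>\<^sub>\<sigma>(f) - z\<close> is invertible as soon as \<open>z > \<parallel>f\<parallel>\<^sub>2\<close>.

  Second, in a C*-algebra with a separating trace vector \<open>\<delta>\<close> this estimate forces density of the
  invertible elements (lemma \<open>contraction_near_units\<close>). Let \<open>a = v\<bar>a\<bar>\<close> be the polar decomposition, fix
  \<open>t > 0\<close>, and cut \<open>a\<close> into \<open>b = v min(\<bar>a\<bar>, t)\<close> and \<open>a - b = v (\<bar>a\<bar> - t)\<^sub>+\<close>. Since \<open>\<parallel>b\<parallel> \<le> t\<close>, it is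
  enough to see that \<open>a - b\<close> is a limit of invertible elements. If \<open>\<parallel>b\<delta>\<parallel> = t\<close>, then \<open>b\<^sup>*b = t\<^sup>2\<close> by
  faithfulness, so \<open>b / t\<close> is a unitary by finiteness, and \<open>a\<close> itself is invertible. Otherwise there
  is an invertible \<open>c\<close> with \<open>\<parallel>b - c\<parallel> < t\<close>. Put \<open>F\<^sup>2 = (\<bar>a\<bar> - t)\<^sub>+ / t\<close>; then \<open>b\<^sup>*bF = t\<^sup>2F\<close> and
  \<open>a - b = bF\<^sup>2\<close>. Polarization gives \<open>Re \<langle>b\<eta>, c\<eta>\<rangle> \<ge> 0\<close> for \<open>\<eta>\<close> in the range of \<open>F\<close>, that is, \<open>Fc\<^sup>*bF\<close> is
  accretive. So \<open>\<epsilon> + Fc\<^sup>*bF\<close>, hence also \<open>\<epsilon> + c\<^sup>*bF\<^sup>2\<close>, is invertible for all \<open>\<epsilon> > 0\<close>, and dividing by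
  \<open>c\<^sup>*\<close> exhibits \<open>bF\<^sup>2\<close> as a limit of invertible elements. This shortcut avoids Rordam's
  theory of distances to the invertible elements.

  No polar decomposition is needed: apart from \<open>c\<close>, only continuous functions of \<open>a\<^sup>*a\<close> and products
  of \<open>a\<close> with such functions occur.
\<close>

unbundle inner_syntax
notation bop_apply (infixr "\<cdot>" 75)

section \<open>Hilbert space and Banach algebra structure\<close>

lemma square_summable_Rep: "square_summable (Rep_ell2 \<xi>)"
  using Rep_ell2[of \<xi>] by simp

lemma abs_summable_product:
  assumes "square_summable f" "square_summable g"
  shows "(\<lambda>x. cmod (f x * cnj (g x))) summable_on UNIV"
proof (rule Infinite_Sum.abs_summable_on_comparison_test')
  show "(\<lambda>x. (cmod (f x))\<^sup>2 + (cmod (g x))\<^sup>2) summable_on UNIV"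
    using assms unfolding square_summable_def by (rule summable_on_add)
  show "cmod (f x * cnj (g x)) \<le> (cmod (f x))\<^sup>2 + (cmod (g x))\<^sup>2" for x
  proof -
    have "0 \<le> (cmod (f x) - cmod (g x))\<^sup>2" "0 \<le> cmod (f x) * cmod (g x)" by simp_all
    then have "cmod (f x) * cmod (g x) \<le> (cmod (f x))\<^sup>2 + (cmod (g x))\<^sup>2"
      unfolding power2_diff by linarith
    then show ?thesis by (simp add: norm_mult)
  qed
qed

lemma summable_product: "(\<lambda>x. Rep_ell2 \<xi> x * cnj (Rep_ell2 \<eta> x)) summable_on UNIV"
  by (rule abs_summable_summable[OF abs_summable_product]) (rule square_summable_Rep)+

lemma cinner_add_left: "cinner (\<xi> + \<eta>) \<zeta> = cinner \<xi> \<zeta> + cinner \<eta> \<zeta>"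
  unfolding cinner_def plus_ell2.rep_eq
  by (simp add: algebra_simps infsum_add summable_product)

lemma cinner_scaleC_left: "cinner (scaleC_ell2 c \<xi>) \<eta> = c * cinner \<xi> \<eta>"
  unfolding cinner_def scaleC_ell2.rep_eq
  by (simp add: mult.assoc infsum_cmult_right')

lemma cinner_commute: "cinner \<eta> \<xi> = cnj (cinner \<xi> \<eta>)"
  unfolding cinner_def infsum_cnj[symmetric] by (simp add: mult.commute)

lemma norm_ell2_square: "(norm \<xi>)\<^sup>2 = (\<Sum>\<^sub>\<infinity>x. (cmod (Rep_ell2 \<xi> x))\<^sup>2)"
  by (simp add: norm_ell2.rep_eq infsum_nonneg)

lemma cinner_self: "cinner \<xi> \<xi> = complex_of_real ((norm \<xi>)\<^sup>2)"
proof -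
  have s: "(\<lambda>x. (cmod (Rep_ell2 \<xi> x))\<^sup>2) summable_on UNIV"
    using square_summable_Rep[of \<xi>] by (simp add: square_summable_def)
  have "cinner \<xi> \<xi> = (\<Sum>\<^sub>\<infinity>x. complex_of_real ((cmod (Rep_ell2 \<xi> x))\<^sup>2))"
    unfolding cinner_def by (simp only: complex_norm_square)
  also have "\<dots> = complex_of_real ((norm \<xi>)\<^sup>2)"
    unfolding norm_ell2_square using has_sum_of_real[OF has_sum_infsum[OF s]] by (rule infsumI)
  finally show ?thesis .
qed

text \<open>The real part of the complex inner product is a real inner product with the same norm.
  For complex-linear operators it determines the complex one (replace a vector by its product
  with \<open>\<i>\<close>), so that real Hilbert space theory suffices from here on.\<close>

instantiation ell2 :: (type) real_inner
begin

definition inner_ell2 :: "'a ell2 \<Rightarrow> 'a ell2 \<Rightarrow> real" where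
  "inner_ell2 \<xi> \<eta> = Re (cinner \<xi> \<eta>)"

instance
proof
  fix \<xi> \<eta> \<zeta> :: "'a ell2" and r :: real
  show "\<xi> \<bullet> \<eta> = \<eta> \<bullet> \<xi>"
    unfolding inner_ell2_def by (subst cinner_commute) simp
  show "(\<xi> + \<eta>) \<bullet> \<zeta> = \<xi> \<bullet> \<zeta> + \<eta> \<bullet> \<zeta>"
    by (simp add: inner_ell2_def cinner_add_left)
  show "(r *\<^sub>R \<xi>) \<bullet> \<eta> = r * (\<xi> \<bullet> \<eta>)"
    by (simp add: inner_ell2_def scaleR_scaleC_ell2 cinner_scaleC_left)
  have self: "\<xi> \<bullet> \<xi> = (norm \<xi>)\<^sup>2"
    by (simp add: inner_ell2_def cinner_self)
  show "0 \<le> \<xi> \<bullet> \<xi>" "\<xi> \<bullet> \<xi> = 0 \<longleftrightarrow> \<xi> = 0" "norm \<xi> = sqrt (\<xi> \<bullet> \<xi>)"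
    unfolding self by simp_all
qed

end

lemma norm_Rep_le: "cmod (Rep_ell2 \<xi> x) \<le> norm \<xi>"
  using square_summable_sum_le[OF square_summable_Rep, of "{x}" \<xi>]
  by (simp add: L2_set_def norm_ell2.rep_eq)

lemma ell2_eqI: "(\<And>x. Rep_ell2 \<xi> x = Rep_ell2 \<eta> x) \<Longrightarrow> \<xi> = \<eta>"
  by (auto simp: Rep_ell2_inject[symmetric])

lemma Rep_ell2_diff: "Rep_ell2 (\<xi> - \<eta>) x = Rep_ell2 \<xi> x - Rep_ell2 \<eta> x"
  by (simp add: minus_ell2.rep_eq)

lemma Rep_ell2_sum: "Rep_ell2 (sum f F) x = (\<Sum>i\<in>F. Rep_ell2 (f i) x)"
  by (induction F rule: infinite_finite_induct) (simp_all add: zero_ell2.rep_eq plus_ell2.rep_eq)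

instance ell2 :: (type) banach
proof
  fix X :: "nat \<Rightarrow> 'a ell2" assume X: "Cauchy X"
  have "Cauchy (\<lambda>n. Rep_ell2 (X n) x)" for x
  proof (rule CauchyI)
    fix e :: real assume "e > 0"
    then obtain M where M: "norm (X m - X n) < e" if "m \<ge> M" "n \<ge> M" for m n
      using CauchyD[OF X] by metis
    show "\<exists>M. \<forall>m\<ge>M. \<forall>n\<ge>M. norm (Rep_ell2 (X m) x - Rep_ell2 (X n) x) < e"
      using M norm_Rep_le[of "X m - X n" x for m n] unfolding Rep_ell2_diff
      by (intro exI[of _ M]) (meson le_less_trans)
  qed
  then obtain f where f: "(\<lambda>n. Rep_ell2 (X n) x) \<longlonglongrightarrow> f x" for x
    unfolding Cauchy_convergent_iff convergent_def by metis
  have bound: "L2_set (\<lambda>x. cmod (Rep_ell2 (X n) x - f x)) F \<le> e"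
    if n: "n \<ge> M" and M: "\<And>m n. m \<ge> M \<Longrightarrow> n \<ge> M \<Longrightarrow> norm (X m - X n) < e" for n M e F
  proof (cases "finite F")
    case True
    have "(\<lambda>m. L2_set (\<lambda>x. cmod (Rep_ell2 (X n) x - Rep_ell2 (X m) x)) F)
        \<longlonglongrightarrow> L2_set (\<lambda>x. cmod (Rep_ell2 (X n) x - f x)) F"
      unfolding L2_set_def by (intro tendsto_intros f)
    moreover have "L2_set (\<lambda>x. cmod (Rep_ell2 (X n) x - Rep_ell2 (X m) x)) F \<le> e" if "m \<ge> M" for m
      using square_summable_sum_le[OF square_summable_Rep True, of "X n - X m"] M[OF n that]
      by (simp add: Rep_ell2_diff norm_ell2.rep_eq)
    ultimately show ?thesis
      by (intro LIMSEQ_le_const2) auto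
  next
    case False
    then show ?thesis
      using M[OF n n] by (simp add: L2_set_def)
  qed
  have sq: "square_summable f"
  proof -
    obtain M where M: "\<And>m n. m \<ge> M \<Longrightarrow> n \<ge> M \<Longrightarrow> norm (X m - X n) < 1"
      using CauchyD[OF X zero_less_one] by metis
    have "square_summable (\<lambda>x. Rep_ell2 (X M) x - f x)"
      by (rule square_summableI(1)[where b = 1]) (rule bound[OF order_refl M])
    then have "square_summable (\<lambda>x. - 1 * (Rep_ell2 (X M) x - f x))"
      by (rule square_summable_mult)
    from square_summable_add(1)[OF square_summable_Rep[of "X M"] this] show ?thesis by simp
  qed
  have "X \<longlonglongrightarrow> Abs_ell2 f"
  proof (rule LIMSEQ_I)
    fix e :: real assume "e > 0"
    then have "e / 2 > 0" by simp
    then obtain M where M: "\<And>m n. m \<ge> M \<Longrightarrow> n \<ge> M \<Longrightarrow> norm (X m - X n) < e / 2"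
      using CauchyD[OF X] by metis
    have "norm (X n - Abs_ell2 f) \<le> e / 2" if "n \<ge> M" for n
      using square_summableI(2)[of "\<lambda>x. Rep_ell2 (X n) x - f x" "e / 2"] bound[OF that M] sq
      by (simp add: norm_ell2.rep_eq Rep_ell2_diff Abs_ell2_inverse)
    then show "\<exists>M. \<forall>n\<ge>M. norm (X n - Abs_ell2 f) < e"
      using \<open>e > 0\<close> by (intro exI[of _ M]) (smt (verit) field_sum_of_halves)
  qed
  then show "convergent X" by (auto simp: convergent_def)
qed

lemma cinner_delta: "cinner \<xi> (delta g) = Rep_ell2 \<xi> g"
proof -
  have "cinner \<xi> (delta g) = (\<Sum>\<^sub>\<infinity>x\<in>{g}. Rep_ell2 \<xi> x)"
    unfolding cinner_def delta.rep_eq by (rule infsum_cong_neutral) auto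
  then show ?thesis by simp
qed

lemma norm_delta: "norm (delta g) = 1"
proof -
  have "complex_of_real ((norm (delta g))\<^sup>2) = 1"
    using cinner_self[of "delta g"] by (simp add: cinner_delta delta.rep_eq)
  then have "(norm (delta g))\<^sup>2 = 1" by (simp only: of_real_eq_1_iff)
  then show ?thesis by (simp add: power2_eq_1_iff) (use norm_ge_zero[of "delta g"] in linarith)
qed

lemma bounded_linear_bop: "bounded_linear (bop_apply a)"
  using bop_apply[of a] by simp

lemma bop_scaleC: "a \<cdot> scaleC_ell2 c \<xi> = scaleC_ell2 c (a \<cdot> \<xi>)"
  using bop_apply[of a] by simp

lemma bop_eqI: "(\<And>\<xi>. a \<cdot> \<xi> = b \<cdot> \<xi>) \<Longrightarrow> a = b"
  by (auto simp: bop_apply_inject[symmetric])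

lemmas bop_apply_simps [simp] =
  zero_bop.rep_eq one_bop.rep_eq plus_bop.rep_eq uminus_bop.rep_eq minus_bop.rep_eq
  times_bop.rep_eq scaleR_bop.rep_eq scaleC_bop.rep_eq

lemma bop_apply_sum: "sum f F \<cdot> \<xi> = (\<Sum>i\<in>F. f i \<cdot> \<xi>)"
  by (induction F rule: infinite_finite_induct) simp_all

lemmas bop_linear_simps = linear_simps[OF bounded_linear_bop]

lemma norm_bop_apply_le: "norm (a \<cdot> \<xi>) \<le> norm a * norm \<xi>"
  unfolding norm_bop.rep_eq by (rule onorm[OF bounded_linear_bop])

lemma norm_bop_le: "0 \<le> C \<Longrightarrow> (\<And>\<xi>. norm (a \<cdot> \<xi>) \<le> C * norm \<xi>) \<Longrightarrow> norm a \<le> C"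
  unfolding norm_bop.rep_eq by (rule onorm_bound)

lemma tendsto_bop_apply: "X \<longlonglongrightarrow> a \<Longrightarrow> (\<lambda>n. X n \<cdot> \<xi>) \<longlonglongrightarrow> a \<cdot> \<xi>"
proof -
  assume "X \<longlonglongrightarrow> a"
  then have "(\<lambda>n. norm (X n - a) * norm \<xi>) \<longlonglongrightarrow> 0 * norm \<xi>"
    by (intro tendsto_mult_right) (simp add: LIM_zero tendsto_norm_zero)
  then have "(\<lambda>n. X n \<cdot> \<xi> - a \<cdot> \<xi>) \<longlonglongrightarrow> 0"
    by (intro Lim_null_comparison[of "\<lambda>n. X n \<cdot> \<xi> - a \<cdot> \<xi>" "\<lambda>n. norm (X n - a) * norm \<xi>"])
      (auto intro!: always_eventually order_trans[OF _ norm_bop_apply_le])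
  then show ?thesis by (rule LIM_zero_cancel)
qed

instance bop :: (type) banach
proof
  fix X :: "nat \<Rightarrow> 'a bop" assume X: "Cauchy X"
  \<comment> \<open>operators embed isometrically into the Banach space of bounded real-linear maps\<close>
  have iso: "norm (Blinfun (bop_apply a) - Blinfun (bop_apply b)) = norm (a - b)" for a b :: "'a bop"
    by (simp add: norm_blinfun.rep_eq minus_blinfun.rep_eq norm_bop.rep_eq bounded_linear_Blinfun_apply
        bounded_linear_bop fun_diff_def)
  have "Cauchy (\<lambda>n. Blinfun (bop_apply (X n)))"
    using X unfolding Cauchy_def dist_norm iso .
  then obtain T where T: "(\<lambda>n. Blinfun (bop_apply (X n))) \<longlonglongrightarrow> T"
    by (auto simp: Cauchy_convergent_iff convergent_def)
  have T_apply: "(\<lambda>n. X n \<cdot> \<xi>) \<longlonglongrightarrow> blinfun_apply T \<xi>" for \<xi>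
    using blinfun.tendsto[OF T tendsto_const[of \<xi>]]
    by (simp add: bounded_linear_Blinfun_apply bounded_linear_bop)
  have "blinfun_apply T (scaleC_ell2 c \<xi>) = scaleC_ell2 c (blinfun_apply T \<xi>)" for c \<xi>
    using T_apply[of "scaleC_ell2 c \<xi>"] bounded_linear.tendsto[OF bounded_linear_scaleC_ell2 T_apply[of \<xi>], of c]
    unfolding bop_scaleC by (rule LIMSEQ_unique)
  then have S: "bop_apply (Bop (blinfun_apply T)) = blinfun_apply T"
    by (intro Bop_inverse) (auto intro: blinfun.bounded_linear_right)
  then have "Blinfun (bop_apply (Bop (blinfun_apply T))) = T"
    by (simp add: blinfun_apply_inverse)
  with T have "X \<longlonglongrightarrow> Bop (blinfun_apply T)"
    using iso unfolding LIMSEQ_iff by metis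
  then show "convergent X" by (auto simp: convergent_def)
qed

section \<open>Adjoints and invertibility\<close>

lemma Im_cinner: "Im (cinner \<xi> \<eta>) = scaleC_ell2 (- \<i>) \<xi> \<bullet> \<eta>"
  by (simp add: inner_ell2_def cinner_scaleC_left)

lemma is_adjoint_iff_inner: "is_adjoint a b \<longleftrightarrow> (\<forall>\<xi> \<eta>. (a \<cdot> \<xi>) \<bullet> \<eta> = \<xi> \<bullet> (b \<cdot> \<eta>))"
  unfolding is_adjoint_def complex_eq_iff Im_cinner bop_scaleC[symmetric]
  by (auto simp: inner_ell2_def)

lemma is_adjointD: "is_adjoint a b \<Longrightarrow> (a \<cdot> \<xi>) \<bullet> \<eta> = \<xi> \<bullet> (b \<cdot> \<eta>)"
  by (simp add: is_adjoint_iff_inner)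

lemma norm_diff_square: "(norm (u - v))\<^sup>2 = (norm u)\<^sup>2 - 2 * (v \<bullet> u) + (norm v)\<^sup>2"
  for u v :: "'a::real_inner"
  by (simp add: power2_norm_eq_inner inner_diff_left inner_diff_right inner_commute)

lemma is_adjoint_sym: "is_adjoint a b \<Longrightarrow> is_adjoint b a"
  by (metis is_adjoint_iff_inner inner_commute)

lemma is_adjoint_unique:
  assumes "is_adjoint a b" "is_adjoint a b'" shows "b = b'"
proof (rule bop_eqI)
  fix \<eta>
  have "(b \<cdot> \<eta> - b' \<cdot> \<eta>) \<bullet> (b \<cdot> \<eta> - b' \<cdot> \<eta>) = 0"
    using is_adjointD[OF assms(1)] is_adjointD[OF assms(2)]
    by (metis eq_iff_diff_eq_0 inner_diff_right)
  then show "b \<cdot> \<eta> = b' \<cdot> \<eta>" by simp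
qed

lemma is_adjoint_one: "is_adjoint 1 1"
  by (simp add: is_adjoint_iff_inner)

lemma is_adjoint_zero: "is_adjoint 0 0"
  by (simp add: is_adjoint_iff_inner)

lemma is_adjoint_add: "is_adjoint a a' \<Longrightarrow> is_adjoint b b' \<Longrightarrow> is_adjoint (a + b) (a' + b')"
  by (simp add: is_adjoint_iff_inner inner_add_left inner_add_right)

lemma is_adjoint_diff: "is_adjoint a a' \<Longrightarrow> is_adjoint b b' \<Longrightarrow> is_adjoint (a - b) (a' - b')"
  by (simp add: is_adjoint_iff_inner inner_diff_left inner_diff_right)

lemma is_adjoint_mult: "is_adjoint a a' \<Longrightarrow> is_adjoint b b' \<Longrightarrow> is_adjoint (a * b) (b' * a')"
  by (simp add: is_adjoint_iff_inner)

lemma is_adjoint_scaleR: "is_adjoint a a' \<Longrightarrow> is_adjoint (r *\<^sub>R a) (r *\<^sub>R a')"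
  by (simp add: is_adjoint_iff_inner)

lemma is_adjoint_sum: "(\<And>i. i \<in> I \<Longrightarrow> is_adjoint (x i) (y i)) \<Longrightarrow> is_adjoint (sum x I) (sum y I)"
  by (induction I rule: infinite_finite_induct) (auto intro: is_adjoint_zero is_adjoint_add)

lemma cinner_scaleC_right: "cinner \<xi> (scaleC_ell2 c \<eta>) = cnj c * cinner \<xi> \<eta>"
  by (subst (1 2) cinner_commute) (simp add: cinner_scaleC_left)

lemma is_adjoint_scaleC: "is_adjoint a a' \<Longrightarrow> is_adjoint (scaleC_bop c a) (scaleC_bop (cnj c) a')"
  by (simp add: is_adjoint_def cinner_scaleC_left cinner_scaleC_right)

lemma is_adjoint_norm_le:
  assumes "is_adjoint a b" shows "norm b \<le> norm a"
proof (rule norm_bop_le)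
  fix \<eta>
  have "(norm (b \<cdot> \<eta>))\<^sup>2 = (a \<cdot> b \<cdot> \<eta>) \<bullet> \<eta>"
    by (simp add: is_adjointD[OF assms] power2_norm_eq_inner)
  also have "\<dots> \<le> norm (a \<cdot> b \<cdot> \<eta>) * norm \<eta>"
    by (rule norm_cauchy_schwarz)
  also have "\<dots> \<le> norm a * norm (b \<cdot> \<eta>) * norm \<eta>"
    by (intro mult_right_mono norm_bop_apply_le) auto
  finally have "norm (b \<cdot> \<eta>) * norm (b \<cdot> \<eta>) \<le> norm (b \<cdot> \<eta>) * (norm a * norm \<eta>)"
    by (simp add: power2_eq_square mult_ac)
  then show "norm (b \<cdot> \<eta>) \<le> norm a * norm \<eta>"
    by (cases "norm (b \<cdot> \<eta>) = 0") (auto simp: mult_le_cancel_left)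
qed simp

lemma is_adjoint_norm: "is_adjoint a b \<Longrightarrow> norm b = norm a"
  by (intro antisym is_adjoint_norm_le) (auto intro: is_adjoint_sym)

lemma is_adjoint_LIMSEQ:
  assumes "X \<longlonglongrightarrow> a" "Y \<longlonglongrightarrow> b" "\<And>n. is_adjoint (X n) (Y n)"
  shows "is_adjoint a b"
  unfolding is_adjoint_iff_inner
proof (intro allI)
  fix \<xi> \<eta>
  have "(\<lambda>n. (X n \<cdot> \<xi>) \<bullet> \<eta>) \<longlonglongrightarrow> (a \<cdot> \<xi>) \<bullet> \<eta>" "(\<lambda>n. \<xi> \<bullet> (Y n \<cdot> \<eta>)) \<longlonglongrightarrow> \<xi> \<bullet> (b \<cdot> \<eta>)"
    by (intro tendsto_intros tendsto_bop_apply assms(1,2))+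
  then show "(a \<cdot> \<xi>) \<bullet> \<eta> = \<xi> \<bullet> (b \<cdot> \<eta>)"
    unfolding is_adjointD[OF assms(3)] by (rule LIMSEQ_unique)
qed

lemma scaleR_bop_scaleC: "r *\<^sub>R a = scaleC_bop (complex_of_real r) a"
  by (rule bop_eqI) (simp add: scaleR_scaleC_ell2)

lemma scaleC_bop_mult_left: "scaleC_bop c a * b = scaleC_bop c (a * b)"
  by (rule bop_eqI) simp

lemma scaleC_bop_mult_right: "a * scaleC_bop c b = scaleC_bop c (a * b)"
  by (rule bop_eqI) (simp add: bop_scaleC)

lemma scaleC_bop_scaleC: "scaleC_bop c (scaleC_bop d a) = scaleC_bop (c * d) a"
  by (rule bop_eqI) (simp add: scaleC_ell2_scaleC)

lemma scaleC_bop_one: "scaleC_bop 1 a = a"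
  using scaleR_bop_scaleC[of 1 a] by simp

lemma scaleC_bop_add: "scaleC_bop c (a + b) = scaleC_bop c a + scaleC_bop c b"
  by (rule bop_eqI) (simp add: scaleC_ell2_add)

lemma scaleC_bop_diff: "scaleC_bop c (a - b) = scaleC_bop c a - scaleC_bop c b"
  by (rule bop_eqI) (simp add: scaleC_ell2_diff)

lemma scaleC_bop_zero: "scaleC_bop c 0 = 0"
  by (rule bop_eqI) (simp add: scaleC_ell2_zero)

lemma scaleC_ell2_add_scalar: "scaleC_ell2 (c + d) \<xi> = scaleC_ell2 c \<xi> + scaleC_ell2 d \<xi>"
  by transfer (simp add: algebra_simps)

lemma scaleC_bop_add_scalar: "scaleC_bop (c + d) a = scaleC_bop c a + scaleC_bop d a"
  by (rule bop_eqI) (simp add: scaleC_ell2_add_scalar)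

lemma scaleC_bop_zero_scalar: "scaleC_bop 0 a = 0"
  using scaleR_bop_scaleC[of 0 a] by simp

lemma scaleC_bop_minus_scalar: "scaleC_bop (- c) a = - scaleC_bop c a"
  using scaleC_bop_add_scalar[of c "- c" a] by (simp add: scaleC_bop_zero_scalar eq_neg_iff_add_eq_0 add.commute)

lemma scaleC_bop_sum: "scaleC_bop c (sum x I) = (\<Sum>i\<in>I. scaleC_bop c (x i))"
  by (induction I rule: infinite_finite_induct) (auto simp: scaleC_bop_zero scaleC_bop_add)

lemma norm_scaleC_bop: "norm (scaleC_bop c a) = cmod c * norm a"
proof -
  have le: "norm (scaleC_bop c a) \<le> cmod c * norm a" for c and a :: "'a bop"
    by (rule norm_bop_le) (auto simp: norm_scaleC_ell2 mult.assoc intro: mult_left_mono norm_bop_apply_le)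
  show ?thesis
  proof (cases "c = 0")
    case False
    have "norm a \<le> inverse (cmod c) * norm (scaleC_bop c a)"
      using le[of "inverse c" "scaleC_bop c a"] False
      by (simp add: scaleC_bop_scaleC scaleC_bop_one norm_inverse)
    then have "cmod c * norm a \<le> norm (scaleC_bop c a)"
      using False by (simp add: field_simps)
    with le[of c a] show ?thesis by simp
  qed (simp add: scaleC_bop_zero_scalar)
qed

lemma tendsto_scaleC_bop: "X \<longlonglongrightarrow> a \<Longrightarrow> (\<lambda>n. scaleC_bop c (X n)) \<longlonglongrightarrow> scaleC_bop c a"
  by (rule bounded_linear.tendsto[of "scaleC_bop c"])
    (auto intro!: bounded_linear_intro[of _ "cmod c"]
      simp: scaleC_bop_add scaleR_bop_scaleC scaleC_bop_scaleC norm_scaleC_bop mult.commute)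

lemma geometric_sum_left: "(1 - y) * (\<Sum>k<n. y ^ k) = 1 - y ^ n" for y :: "'a::ring_1"
proof (induction n)
  case (Suc n)
  have step: "(1 - y) * (\<Sum>k<Suc n. y ^ k) = (1 - y) * (\<Sum>k<n. y ^ k) + (1 - y) * y ^ n"
    by (simp only: sum.lessThan_Suc distrib_left)
  show ?case unfolding step Suc.IH by (simp add: left_diff_distrib)
qed simp

lemma geometric_sum_right: "(\<Sum>k<n. y ^ k) * (1 - y) = 1 - y ^ n" for y :: "'a::ring_1"
proof (induction n)
  case (Suc n)
  have step: "(\<Sum>k<Suc n. y ^ k) * (1 - y) = (\<Sum>k<n. y ^ k) * (1 - y) + y ^ n * (1 - y)"
    by (simp only: sum.lessThan_Suc distrib_right)
  show ?case unfolding step Suc.IH by (simp add: right_diff_distrib power_commutes)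
qed simp

lemma neumann:
  fixes y :: "'a::{real_normed_algebra_1, banach}"
  assumes "summable (\<lambda>n. y ^ n)"
  shows "(1 - y) * (\<Sum>n. y ^ n) = 1" "(\<Sum>n. y ^ n) * (1 - y) = 1"
proof -
  have lim: "(\<lambda>n. \<Sum>k<n. y ^ k) \<longlonglongrightarrow> (\<Sum>n. y ^ n)"
    using assms by (rule summable_LIMSEQ)
  have one: "(\<lambda>n. 1 - y ^ n) \<longlonglongrightarrow> 1"
    using tendsto_diff[OF tendsto_const summable_LIMSEQ_zero[OF assms], of 1] by simp
  show "(1 - y) * (\<Sum>n. y ^ n) = 1"
    using tendsto_mult[OF tendsto_const lim, of "1 - y"] one
    unfolding geometric_sum_left by (rule LIMSEQ_unique)
  show "(\<Sum>n. y ^ n) * (1 - y) = 1"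
    using tendsto_mult[OF lim tendsto_const, of "1 - y"] one
    unfolding geometric_sum_right by (rule LIMSEQ_unique)
qed

text \<open>For self-adjoint \<open>x\<close>, unit vectors \<open>\<xi>\<close> with \<open>\<parallel>x\<xi>\<parallel>\<close> close to \<open>\<parallel>x\<parallel>\<close> are approximate eigenvectors
  of \<open>x\<^sup>2\<close> for the value \<open>\<parallel>x\<parallel>\<^sup>2\<close>. This is the substitute for the equality of norm and spectral
  radius that the functional calculus needs.\<close>

lemma norm_square_in_spectrum:
  assumes "is_adjoint x x" "b * ((norm x)\<^sup>2 *\<^sub>R 1 - x * x) = 1"
  shows False
proof -
  define l B where "l = (norm x)\<^sup>2" and "B = (norm b)\<^sup>2"
  have "b \<noteq> 0" using assms(2) by auto
  then have B: "B > 0" by (simp add: B_def)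
  have key: "(norm \<xi>)\<^sup>2 \<le> B * (2 * l * (l * (norm \<xi>)\<^sup>2 - (norm (x \<cdot> \<xi>))\<^sup>2))" for \<xi>
  proof -
    have "\<xi> = b \<cdot> (l *\<^sub>R \<xi> - x \<cdot> x \<cdot> \<xi>)"
      using arg_cong[OF assms(2), of "\<lambda>u. u \<cdot> \<xi>"] by (simp add: l_def)
    then have "norm \<xi> \<le> norm b * norm (l *\<^sub>R \<xi> - x \<cdot> x \<cdot> \<xi>)"
      by (metis norm_bop_apply_le)
    then have "(norm \<xi>)\<^sup>2 \<le> B * (norm (l *\<^sub>R \<xi> - x \<cdot> x \<cdot> \<xi>))\<^sup>2"
      by (metis B_def norm_ge_zero power_mono power_mult_distrib)
    also have "(norm (l *\<^sub>R \<xi> - x \<cdot> x \<cdot> \<xi>))\<^sup>2 =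
        l\<^sup>2 * (norm \<xi>)\<^sup>2 - 2 * l * (norm (x \<cdot> \<xi>))\<^sup>2 + (norm (x \<cdot> x \<cdot> \<xi>))\<^sup>2"
      using is_adjointD[OF assms(1), of "x \<cdot> \<xi>" \<xi>]
      by (simp add: norm_diff_square power_mult_distrib power2_norm_eq_inner[of "x \<cdot> \<xi>"])
    also have "\<dots> \<le> 2 * l * (l * (norm \<xi>)\<^sup>2 - (norm (x \<cdot> \<xi>))\<^sup>2)"
    proof -
      have "norm (x \<cdot> x \<cdot> \<xi>) \<le> norm x * norm (x \<cdot> \<xi>)" "norm (x \<cdot> \<xi>) \<le> norm x * norm \<xi>"
        by (rule norm_bop_apply_le)+
      then have "norm (x \<cdot> x \<cdot> \<xi>) \<le> norm x * (norm x * norm \<xi>)"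
        by (meson mult_left_mono norm_ge_zero order_trans)
      then have "(norm (x \<cdot> x \<cdot> \<xi>))\<^sup>2 \<le> (norm x * (norm x * norm \<xi>))\<^sup>2"
        by (simp add: power_mono)
      then show ?thesis by (simp add: l_def power2_eq_square algebra_simps)
    qed
    finally show ?thesis using B by (simp add: mult_left_mono)
  qed
  have "l \<noteq> 0" using key[of "delta undefined"] by (auto simp: delta_nonzero)
  then have l: "l > 0" by (simp add: l_def)
  define c where "c = l - 1 / (2 * l * B)"
  have c: "(norm (x \<cdot> \<xi>))\<^sup>2 \<le> c * (norm \<xi>)\<^sup>2" for \<xi>
    using key[of \<xi>] l B by (simp add: c_def field_simps)
  have "0 \<le> c * (norm (delta undefined :: 'a ell2))\<^sup>2"
    using c by (meson order_trans zero_le_power2)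
  then have c0: "c \<ge> 0"
    by (simp add: zero_le_mult_iff delta_nonzero)
  have "norm x \<le> sqrt c"
    using c c0 by (intro norm_bop_le real_sqrt_ge_zero) (metis norm_ge_zero real_le_rsqrt real_sqrt_mult real_sqrt_abs abs_norm_cancel)+
  then have "l \<le> c"
    using c0 by (metis l_def norm_ge_zero power_mono real_sqrt_pow2)
  then show False using mult_pos_pos[OF l B] by (simp add: c_def mult.commute)
qed

lemma cstar_subalgebraD:
  assumes "cstar_subalgebra A"
  shows "closed A" "0 \<in> A" "a \<in> A \<Longrightarrow> b \<in> A \<Longrightarrow> a + b \<in> A" "a \<in> A \<Longrightarrow> b \<in> A \<Longrightarrow> a * b \<in> A"
    "a \<in> A \<Longrightarrow> scaleC_bop c a \<in> A" "a \<in> A \<Longrightarrow> is_adjoint a b \<Longrightarrow> b \<in> A"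
  using assms by (auto simp: cstar_subalgebra_def)

lemma cstar_subalgebra_generated: "cstar_subalgebra (cstar_generated X)"
  unfolding cstar_subalgebra_def[of "cstar_generated X"]
proof (intro conjI ballI allI impI)
  show "closed (cstar_generated X)"
    unfolding cstar_generated_def by (rule closed_Inter) (simp add: cstar_subalgebraD(1))
  show "0 \<in> cstar_generated X"
    unfolding cstar_generated_def by (blast intro: cstar_subalgebraD(2))
  fix a assume a: "a \<in> cstar_generated X"
  show "scaleC_bop c a \<in> cstar_generated X" for c
    using a unfolding cstar_generated_def by (blast intro: cstar_subalgebraD(5))
  show "b \<in> cstar_generated X" if "is_adjoint a b" for b
    using a that unfolding cstar_generated_def by (blast intro: cstar_subalgebraD(6))
  fix b assume b: "b \<in> cstar_generated X"
  show "a + b \<in> cstar_generated X"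
    using a b unfolding cstar_generated_def by (blast intro: cstar_subalgebraD(3))
  show "a * b \<in> cstar_generated X"
    using a b unfolding cstar_generated_def by (blast intro: cstar_subalgebraD(4))
qed

locale unital_cstar_algebra =
  fixes A :: "'g bop set"
  assumes cstar: "cstar_subalgebra A"
    and one_closed: "1 \<in> A"
    and adjoint_exists: "a \<in> A \<Longrightarrow> \<exists>b. is_adjoint a b"
begin

lemma closed_A: "closed A"
  and zero_closed: "0 \<in> A"
  and add_closed: "a \<in> A \<Longrightarrow> b \<in> A \<Longrightarrow> a + b \<in> A"
  and mult_closed: "a \<in> A \<Longrightarrow> b \<in> A \<Longrightarrow> a * b \<in> A"
  and scaleC_closed: "a \<in> A \<Longrightarrow> scaleC_bop c a \<in> A"
  and adjoint_closed: "a \<in> A \<Longrightarrow> is_adjoint a b \<Longrightarrow> b \<in> A"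
  using cstar_subalgebraD[OF cstar] by blast+

lemma scaleR_closed: "a \<in> A \<Longrightarrow> r *\<^sub>R a \<in> A"
  unfolding scaleR_bop_scaleC by (rule scaleC_closed)

lemma diff_closed: "a \<in> A \<Longrightarrow> b \<in> A \<Longrightarrow> a - b \<in> A"
  using add_closed[OF _ scaleR_closed[of b "- 1"]] by simp

lemma power_closed: "a \<in> A \<Longrightarrow> a ^ n \<in> A"
  by (induction n) (auto intro: one_closed mult_closed)

lemma sum_closed: "(\<And>i. i \<in> I \<Longrightarrow> f i \<in> A) \<Longrightarrow> sum f I \<in> A"
  by (induction I rule: infinite_finite_induct) (auto intro: zero_closed add_closed)

lemma limit_closed: "X \<longlonglongrightarrow> a \<Longrightarrow> (\<And>n. X n \<in> A) \<Longrightarrow> a \<in> A"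
  using closed_A closed_sequential_limits by blast

abbreviation units :: "'g bop set" where
  "units \<equiv> invertible_elements A"

lemma units_I: "a \<in> A \<Longrightarrow> b \<in> A \<Longrightarrow> a * b = 1 \<Longrightarrow> b * a = 1 \<Longrightarrow> a \<in> units"
  by (auto simp: invertible_elements_def)

lemma units_E:
  assumes "a \<in> units"
  obtains b where "a \<in> A" "b \<in> A" "a * b = 1" "b * a = 1"
  using assms by (auto simp: invertible_elements_def)

lemma units_mult:
  assumes "a \<in> units" "b \<in> units" shows "a * b \<in> units"
proof -
  obtain a' where a: "a \<in> A" "a' \<in> A" "a * a' = 1" "a' * a = 1" by (rule units_E[OF assms(1)])
  obtain b' where b: "b \<in> A" "b' \<in> A" "b * b' = 1" "b' * b = 1" by (rule units_E[OF assms(2)])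
  have "a * b * (b' * a') = a * (b * b') * a'" "b' * a' * (a * b) = b' * (a' * a) * b"
    by (simp_all only: mult.assoc)
  then show ?thesis
    using a b by (intro units_I[of _ "b' * a'"] mult_closed) simp_all
qed

lemma units_scaleR:
  assumes "a \<in> units" "r \<noteq> 0" shows "r *\<^sub>R a \<in> units"
proof -
  obtain a' where a: "a \<in> A" "a' \<in> A" "a * a' = 1" "a' * a = 1" by (rule units_E[OF assms(1)])
  then show ?thesis
    using assms(2) by (intro units_I[of _ "inverse r *\<^sub>R a'"] scaleR_closed) simp_all
qed

lemma units_scaleC:
  assumes "a \<in> units" "c \<noteq> 0" shows "scaleC_bop c a \<in> units"
proof -
  obtain a' where a: "a \<in> A" "a' \<in> A" "a * a' = 1" "a' * a = 1" by (rule units_E[OF assms(1)])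
  then show ?thesis
    using assms(2) by (intro units_I[of _ "scaleC_bop (inverse c) a'"] scaleC_closed)
      (simp_all add: scaleC_bop_mult_left scaleC_bop_mult_right scaleC_bop_scaleC scaleC_bop_one)
qed

lemma near_one_in_units:
  assumes "a \<in> A" "norm (1 - a) < 1"
  shows "a \<in> units"
proof -
  define y where "y = 1 - a"
  have s: "summable (\<lambda>n. y ^ n)"
    using assms(2) by (intro complete_algebra_summable_geometric) (simp add: y_def)
  have "(\<Sum>n. y ^ n) \<in> A"
    using summable_LIMSEQ[OF s]
    by (rule limit_closed) (auto simp: y_def intro!: sum_closed power_closed diff_closed one_closed assms)
  then show ?thesis
    using neumann[OF s] assms(1) by (intro units_I[of a "\<Sum>n. y ^ n"]) (simp_all add: y_def)
qed

text \<open>A strictly accretive operator is invertible inside the algebra: scaled by a small positive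
  number it comes within distance less than one of the identity.\<close>

lemma accretive_in_units:
  assumes "x \<in> A" "\<epsilon> > 0" and acc: "\<And>\<xi>. \<epsilon> * (norm \<xi>)\<^sup>2 \<le> (x \<cdot> \<xi>) \<bullet> \<xi>"
  shows "x \<in> units"
proof -
  define N where "N = (norm x)\<^sup>2 + \<epsilon>\<^sup>2"
  define k where "k = \<epsilon> / N"
  have N: "N > 0" using \<open>\<epsilon> > 0\<close> by (simp add: N_def add_nonneg_pos)
  then have k: "k > 0" using \<open>\<epsilon> > 0\<close> by (simp add: k_def)
  define c where "c = 1 - 2 * k * \<epsilon> + k\<^sup>2 * (norm x)\<^sup>2"
  have N_eqs: "k * \<epsilon> = k\<^sup>2 * N" "(norm x)\<^sup>2 = N - \<epsilon>\<^sup>2"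
    using N by (simp_all add: k_def N_def[symmetric] power2_eq_square) (simp add: N_def power2_eq_square)
  have "c = 1 - 2 * (k * \<epsilon>) + k\<^sup>2 * (norm x)\<^sup>2"
    by (simp add: c_def)
  then have "c = 1 - k\<^sup>2 * N - k\<^sup>2 * \<epsilon>\<^sup>2"
    unfolding N_eqs by (simp add: algebra_simps)
  then have c1: "c < 1" using N k \<open>\<epsilon> > 0\<close>
    by (smt (verit) mult_pos_pos zero_less_power)
  have bound: "(norm ((1 - k *\<^sub>R x) \<cdot> \<xi>))\<^sup>2 \<le> c * (norm \<xi>)\<^sup>2" for \<xi>
  proof -
    have "(norm ((1 - k *\<^sub>R x) \<cdot> \<xi>))\<^sup>2 = (norm \<xi>)\<^sup>2 - 2 * k * ((x \<cdot> \<xi>) \<bullet> \<xi>) + k\<^sup>2 * (norm (x \<cdot> \<xi>))\<^sup>2"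
      by (simp add: norm_diff_square power_mult_distrib)
    moreover have "2 * k * (\<epsilon> * (norm \<xi>)\<^sup>2) \<le> 2 * k * ((x \<cdot> \<xi>) \<bullet> \<xi>)"
      using k acc by (intro mult_left_mono) auto
    moreover have "(norm (x \<cdot> \<xi>))\<^sup>2 \<le> (norm x)\<^sup>2 * (norm \<xi>)\<^sup>2"
      using norm_bop_apply_le[of x \<xi>] by (metis norm_ge_zero power_mono power_mult_distrib)
    then have "k\<^sup>2 * (norm (x \<cdot> \<xi>))\<^sup>2 \<le> k\<^sup>2 * ((norm x)\<^sup>2 * (norm \<xi>)\<^sup>2)"
      by (intro mult_left_mono) auto
    ultimately show ?thesis by (simp add: c_def algebra_simps)
  qed
  have "0 \<le> c * (norm (delta undefined :: 'g ell2))\<^sup>2"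
    using bound by (meson order_trans zero_le_power2)
  then have c0: "c \<ge> 0"
    by (simp add: zero_le_mult_iff delta_nonzero)
  have "norm (1 - k *\<^sub>R x) \<le> sqrt c"
    using bound c0 by (intro norm_bop_le real_sqrt_ge_zero) (metis norm_ge_zero real_le_rsqrt real_sqrt_mult real_sqrt_abs abs_norm_cancel)+
  also have "sqrt c < 1" using c1 by simp
  finally have "k *\<^sub>R x \<in> units"
    by (intro near_one_in_units scaleR_closed assms)
  then have "inverse k *\<^sub>R (k *\<^sub>R x) \<in> units"
    by (rule units_scaleR) (use k in simp)
  then show ?thesis using k by simp
qed

text \<open>A left inverse bounds \<open>y\<close> from below, which makes \<open>y\<^sup>*y\<close> strictly accretive. This is the core of
  spectral permanence: an inverse of \<open>y\<close> among all bounded operators equals \<open>(y\<^sup>*y)\<^sup>-\<^sup>1 y\<^sup>*\<close>.\<close>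

lemma left_invertible_adjoint_mult_in_units:
  assumes "y \<in> A" "is_adjoint y y'" "z * y = 1"
  shows "y' * y \<in> units"
proof (rule accretive_in_units)
  show "y' * y \<in> A" by (intro mult_closed adjoint_closed[OF assms(1,2)] assms(1))
  have "z \<noteq> 0" using assms(3) by auto
  then show "inverse ((norm z)\<^sup>2) > 0" by simp
  fix \<xi>
  have "norm \<xi> \<le> norm z * norm (y \<cdot> \<xi>)"
    using arg_cong[OF assms(3), of "\<lambda>u. u \<cdot> \<xi>"] norm_bop_apply_le[of z "y \<cdot> \<xi>"] by simp
  then have "(norm \<xi>)\<^sup>2 \<le> (norm z)\<^sup>2 * (norm (y \<cdot> \<xi>))\<^sup>2"
    by (metis norm_ge_zero power_mono power_mult_distrib)
  also have "(norm (y \<cdot> \<xi>))\<^sup>2 = ((y' * y) \<cdot> \<xi>) \<bullet> \<xi>"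
    using is_adjointD[OF is_adjoint_sym[OF assms(2)], of "y \<cdot> \<xi>" \<xi>] by (simp add: power2_norm_eq_inner)
  finally show "inverse ((norm z)\<^sup>2) * (norm \<xi>)\<^sup>2 \<le> ((y' * y) \<cdot> \<xi>) \<bullet> \<xi>"
    using \<open>z \<noteq> 0\<close> by (simp add: field_simps)
qed

lemma invertible_in_units:
  assumes "y \<in> A" "y \<in> invertible_elements UNIV"
  shows "y \<in> units"
proof -
  obtain z where z: "y * z = 1" "z * y = 1"
    using assms(2) by (auto simp: invertible_elements_def)
  obtain y' where y': "is_adjoint y y'" using adjoint_exists[OF assms(1)] by auto
  have "y' * y \<in> units"
    using assms(1) y' z(2) by (rule left_invertible_adjoint_mult_in_units)
  then obtain w where w: "w \<in> A" "w * (y' * y) = 1" by (rule units_E)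
  have "z = w * (y' * y) * z" using w by simp
  also have "\<dots> = w * y' * (y * z)" by (simp only: mult.assoc)
  finally have "z \<in> A" using w z adjoint_closed[OF assms(1) y'] by (simp add: mult_closed)
  then show ?thesis using z assms(1) by (rule units_I[rotated])
qed

lemma units_adjoint:
  assumes "c \<in> units" "is_adjoint c c'"
  shows "c' \<in> units"
proof -
  obtain d where d: "c \<in> A" "d \<in> A" "c * d = 1" "d * c = 1" by (rule units_E[OF assms(1)])
  obtain d' where d': "is_adjoint d d'" using adjoint_exists[OF d(2)] by auto
  have "d' * c' = 1"
    using is_adjoint_mult[OF assms(2) d'] unfolding d(3) by (rule is_adjoint_unique[OF _ is_adjoint_one])
  moreover have "c' * d' = 1"
    using is_adjoint_mult[OF d' assms(2)] unfolding d(4) by (rule is_adjoint_unique[OF _ is_adjoint_one])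
  ultimately show ?thesis
    using d d' assms(2) by (intro units_I[of _ d']) (auto intro: adjoint_closed)
qed

end

section \<open>Continuous functional calculus\<close>

definition op_poly :: "'g bop \<Rightarrow> complex poly \<Rightarrow> 'g bop" where
  "op_poly h p = fold_coeffs (\<lambda>c x. scaleC_bop c 1 + h * x) p 0"

lemma op_poly_0 [simp]: "op_poly h 0 = 0"
  by (simp add: op_poly_def)

lemma op_poly_pCons [simp]: "op_poly h (pCons c p) = scaleC_bop c 1 + h * op_poly h p"
  by (cases "p = 0 \<and> c = 0") (auto simp: op_poly_def scaleC_bop_zero_scalar)

lemma op_poly_add: "op_poly h (p + q) = op_poly h p + op_poly h q"
  by (induction p q rule: poly_induct2) (simp_all add: scaleC_bop_add_scalar distrib_left)

lemma op_poly_smult: "op_poly h (smult c p) = scaleC_bop c (op_poly h p)"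
  by (induction p) (simp_all add: scaleC_bop_add scaleC_bop_scaleC scaleC_bop_mult_right scaleC_bop_zero)

lemma op_poly_diff: "op_poly h (p - q) = op_poly h p - op_poly h q"
  using op_poly_add[of h p "smult (- 1) q"] op_poly_smult[of h "- 1" q]
  by (simp add: scaleC_bop_minus_scalar scaleC_bop_one)

lemma op_poly_mult: "op_poly h (p * q) = op_poly h p * op_poly h q"
  by (induction p)
    (simp_all add: op_poly_add op_poly_smult scaleC_bop_mult_left distrib_right mult.assoc scaleC_bop_zero_scalar)

lemma selfadjoint_inner_scaleC:
  assumes "is_adjoint h h"
  shows "scaleC_ell2 w (h \<cdot> \<xi>) \<bullet> \<xi> = Re w * ((h \<cdot> \<xi>) \<bullet> \<xi>)"
proof -
  have "cinner (h \<cdot> \<xi>) \<xi> = cnj (cinner (h \<cdot> \<xi>) \<xi>)"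
    using assms cinner_commute unfolding is_adjoint_def by metis
  then have "Im (cinner (h \<cdot> \<xi>) \<xi>) = 0" by (simp add: complex_eq_iff)
  then show ?thesis by (simp add: inner_ell2_def cinner_scaleC_left)
qed

locale positive_contraction = unital_cstar_algebra +
  fixes h
  assumes h_closed: "h \<in> A"
    and selfadjoint: "is_adjoint h h"
    and nonneg: "0 \<le> (h \<cdot> \<xi>) \<bullet> \<xi>"
    and le_one: "(h \<cdot> \<xi>) \<bullet> \<xi> \<le> (norm \<xi>)\<^sup>2"
begin

lemma op_poly_closed: "op_poly h p \<in> A"
  by (induction p) (auto intro: zero_closed one_closed add_closed mult_closed scaleC_closed h_closed)

lemma shift_in_units:
  assumes z: "z \<notin> of_real ` {0..1}"
  shows "scaleC_bop (- z) 1 + h \<in> units"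
proof -
  \<comment> \<open>rotate by \<open>w\<close> to move the segment \<open>[0,1] - z\<close> into an open right half plane\<close>
  obtain w e where w: "w \<noteq> 0" "e > 0" "\<And>t. 0 \<le> t \<Longrightarrow> t \<le> 1 \<Longrightarrow> e \<le> Re (- (w * z)) + Re w * t"
  proof (cases "Im z = 0")
    case False
    then have "Im z * Im z > 0" by (simp add: zero_less_mult_iff) linarith
    with False show ?thesis
      by (intro that[of "\<i> * of_real (Im z)" "Im z * Im z"]) auto
  next
    case True
    then have "z = of_real (Re z)" by (simp add: complex_eq_iff)
    with z have "Re z < 0 \<or> Re z > 1" by (metis atLeastAtMost_iff image_eqI not_less)
    then show ?thesis
    proof
      assume "Re z < 0" then show ?thesis by (intro that[of 1 "- Re z"]) auto
    next
      assume "Re z > 1" then show ?thesis by (intro that[of "- 1" "Re z - 1"]) auto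
    qed
  qed
  let ?x = "scaleC_bop (- z) 1 + h"
  have "scaleC_bop w ?x \<in> units"
  proof (rule accretive_in_units)
    show "scaleC_bop w ?x \<in> A"
      by (intro scaleC_closed add_closed one_closed h_closed)
    show "e > 0" by (rule w)
    fix \<xi>
    have "(scaleC_bop w ?x \<cdot> \<xi>) \<bullet> \<xi> = Re (- (w * z)) * (norm \<xi>)\<^sup>2 + Re w * ((h \<cdot> \<xi>) \<bullet> \<xi>)"
      using selfadjoint_inner_scaleC[OF is_adjoint_one, of "- (w * z)" \<xi>]
      by (simp add: scaleC_ell2_add inner_add_left selfadjoint_inner_scaleC[OF selfadjoint]
          scaleC_ell2_scaleC power2_norm_eq_inner)
    moreover have "e * (norm \<xi>)\<^sup>2 \<le> Re (- (w * z)) * (norm \<xi>)\<^sup>2 + Re w * ((h \<cdot> \<xi>) \<bullet> \<xi>)"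
    proof (cases "\<xi> = 0")
      case False
      then have n: "(norm \<xi>)\<^sup>2 > 0" by simp
      define t where "t = ((h \<cdot> \<xi>) \<bullet> \<xi>) / (norm \<xi>)\<^sup>2"
      have "0 \<le> t" "t \<le> 1" using nonneg[of \<xi>] le_one[of \<xi>] n by (simp_all add: t_def)
      then have "e * (norm \<xi>)\<^sup>2 \<le> (Re (- (w * z)) + Re w * t) * (norm \<xi>)\<^sup>2"
        using n by (intro mult_right_mono w) auto
      also have "\<dots> = Re (- (w * z)) * (norm \<xi>)\<^sup>2 + Re w * ((h \<cdot> \<xi>) \<bullet> \<xi>)"
        using False by (simp add: t_def distrib_right)
      finally show ?thesis .
    qed (simp add: bop_linear_simps)
    ultimately show "e * (norm \<xi>)\<^sup>2 \<le> (scaleC_bop w ?x \<cdot> \<xi>) \<bullet> \<xi>" by simp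
  qed
  then have "scaleC_bop (inverse w) (scaleC_bop w ?x) \<in> units"
    by (rule units_scaleC) (use w in simp)
  then show ?thesis using w by (simp only: scaleC_bop_scaleC) (simp add: scaleC_bop_one)
qed

text \<open>Spectral mapping: factor the polynomial over \<open>\<complex>\<close>; every linear factor \<open>h - z\<close> is invertible.\<close>

lemma op_poly_in_units:
  assumes "\<And>s. 0 \<le> s \<Longrightarrow> s \<le> 1 \<Longrightarrow> poly p (of_real s) \<noteq> 0"
  shows "op_poly h p \<in> units"
  using assms
proof (induction "degree p" arbitrary: p rule: less_induct)
  case (less p)
  show ?case
  proof (cases "degree p = 0")
    case True
    then obtain c where p: "p = [:c:]" by (rule degree_eq_zeroE)
    have one: "1 \<in> units" by (rule units_I) (simp_all add: one_closed)
    have "c \<noteq> 0" using less.prems[of 0] p by simp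
    then show ?thesis using units_scaleC[OF one] by (simp add: p)
  next
    case False
    then have "\<not> constant (poly p)" by (simp add: constant_degree)
    then obtain z where z: "poly p z = 0" using fundamental_theorem_of_algebra by blast
    then obtain q where p: "p = [:- z, 1:] * q" by (auto simp: poly_eq_0_iff_dvd)
    have "q \<noteq> 0" using False p by auto
    then have "degree p = 1 + degree q" unfolding p by (subst degree_mult_eq) auto
    moreover have "poly q (of_real s) \<noteq> 0" if "0 \<le> s" "s \<le> 1" for s
      using less.prems[OF that] by (simp add: p)
    ultimately have "op_poly h q \<in> units" by (intro less.hyps) auto
    moreover have "z \<notin> of_real ` {0..1}" using less.prems z by auto
    then have "op_poly h [:- z, 1:] \<in> units"
      using shift_in_units by (simp add: scaleC_bop_one)
    ultimately show ?thesis unfolding p op_poly_mult by (rule units_mult[rotated])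
  qed
qed

text \<open>If \<open>x = p(h)\<close> had norm above the supremum of \<open>\<bar>p\<bar>\<close>, then \<open>\<parallel>x\<parallel>\<^sup>2 - p\<^sup>2\<close> would have no zero on \<open>[0,1]\<close>, so
  \<open>\<parallel>x\<parallel>\<^sup>2 - x\<^sup>2\<close> would be invertible.\<close>

lemma norm_op_poly_le:
  assumes "is_adjoint (op_poly h p) (op_poly h p)"
    and le: "\<And>s. 0 \<le> s \<Longrightarrow> s \<le> 1 \<Longrightarrow> cmod (poly p (of_real s)) \<le> C"
  shows "norm (op_poly h p) \<le> C"
proof (rule ccontr)
  assume less: "\<not> norm (op_poly h p) \<le> C"
  define x where "x = op_poly h p"
  define q where "q = [:of_real ((norm x)\<^sup>2):] - p * p"
  have C: "0 \<le> C" using order_trans[OF norm_ge_zero le[of 0]] by simp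
  have "poly q (of_real s) \<noteq> 0" if "0 \<le> s" "s \<le> 1" for s
  proof
    assume "poly q (of_real s) = 0"
    then have "(poly p (of_real s))\<^sup>2 = of_real ((norm x)\<^sup>2)"
      by (simp add: q_def power2_eq_square)
    then have "cmod ((poly p (of_real s))\<^sup>2) = (norm x)\<^sup>2"
      by (metis norm_of_real abs_of_nonneg zero_le_power2)
    then have "(cmod (poly p (of_real s)))\<^sup>2 = (norm x)\<^sup>2" by (simp add: norm_power)
    then have "cmod (poly p (of_real s)) = norm x" by simp
    with le[OF that] less show False by (simp add: x_def)
  qed
  then have "op_poly h q \<in> units" by (rule op_poly_in_units)
  then obtain b where "b * op_poly h q = 1" by (rule units_E)
  moreover have "op_poly h q = (norm x)\<^sup>2 *\<^sub>R 1 - x * x"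
    by (simp add: q_def op_poly_diff op_poly_mult x_def scaleR_bop_scaleC)
  ultimately show False
    using norm_square_in_spectrum assms(1) by (metis x_def)
qed

text \<open>The graph of the functional calculus. The polynomials are complex, so that they factor, but
  are required to give self-adjoint operators; this replaces having real coefficients.\<close>

definition fcalc :: "(real \<Rightarrow> real) \<Rightarrow> 'a bop \<Rightarrow> bool" where
  "fcalc f x \<longleftrightarrow> (\<exists>P. (\<forall>n. is_adjoint (op_poly h (P n)) (op_poly h (P n))) \<and>
     uniform_limit {0..1} (\<lambda>n s. poly (P n) (of_real s)) (\<lambda>s. of_real (f s)) sequentially \<and>
     (\<lambda>n. op_poly h (P n)) \<longlonglongrightarrow> x)"

lemma fcalc_closed: "fcalc f x \<Longrightarrow> x \<in> A"
  unfolding fcalc_def using limit_closed op_poly_closed by blast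

lemma fcalc_selfadjoint: "fcalc f x \<Longrightarrow> is_adjoint x x"
  unfolding fcalc_def using is_adjoint_LIMSEQ by blast

lemma fcalc_op_poly:
  assumes "is_adjoint (op_poly h p) (op_poly h p)" "\<And>s. poly p (of_real s) = of_real (f s)"
  shows "fcalc f (op_poly h p)"
  unfolding fcalc_def using assms by (intro exI[of _ "\<lambda>_. p"]) (auto intro: uniform_limit_const)

lemma fcalc_const: "fcalc (\<lambda>_. c) (c *\<^sub>R 1)"
  using fcalc_op_poly[of "[:of_real c:]" "\<lambda>_. c"]
  by (simp add: scaleR_bop_scaleC[symmetric] is_adjoint_scaleR is_adjoint_one)

lemma fcalc_id: "fcalc (\<lambda>s. s) h"
  using fcalc_op_poly[of "[:0, 1:]" "\<lambda>s. s"] selfadjoint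
  by (simp add: scaleC_bop_one scaleC_bop_zero_scalar)

lemma fcalc_add:
  assumes "fcalc f x" "fcalc g y" shows "fcalc (\<lambda>s. f s + g s) (x + y)"
proof -
  obtain P where P: "\<And>n. is_adjoint (op_poly h (P n)) (op_poly h (P n))"
     "uniform_limit {0..1} (\<lambda>n s. poly (P n) (of_real s)) (\<lambda>s. of_real (f s)) sequentially"
     "(\<lambda>n. op_poly h (P n)) \<longlonglongrightarrow> x" using assms(1) unfolding fcalc_def by blast
  obtain Q where Q: "\<And>n. is_adjoint (op_poly h (Q n)) (op_poly h (Q n))"
     "uniform_limit {0..1} (\<lambda>n s. poly (Q n) (of_real s)) (\<lambda>s. of_real (g s)) sequentially"
     "(\<lambda>n. op_poly h (Q n)) \<longlonglongrightarrow> y" using assms(2) unfolding fcalc_def by blast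
  have "uniform_limit {0..1} (\<lambda>n s. poly (P n + Q n) (of_real s)) (\<lambda>s. of_real (f s + g s)) sequentially"
    unfolding poly_add of_real_add by (rule uniform_limit_add[OF P(2) Q(2)])
  with P Q show ?thesis
    unfolding fcalc_def by (intro exI[of _ "\<lambda>n. P n + Q n"])
      (auto simp only: op_poly_add intro!: is_adjoint_add tendsto_add)
qed

lemma fcalc_mult:
  assumes "fcalc f x" "fcalc g y"
    and cont: "continuous_on {0..1} f" "continuous_on {0..1} g"
  shows "fcalc (\<lambda>s. f s * g s) (x * y)"
proof -
  obtain P where P: "\<And>n. is_adjoint (op_poly h (P n)) (op_poly h (P n))"
     "uniform_limit {0..1} (\<lambda>n s. poly (P n) (of_real s)) (\<lambda>s. of_real (f s)) sequentially"
     "(\<lambda>n. op_poly h (P n)) \<longlonglongrightarrow> x" using assms(1) unfolding fcalc_def by blast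
  obtain Q where Q: "\<And>n. is_adjoint (op_poly h (Q n)) (op_poly h (Q n))"
     "uniform_limit {0..1} (\<lambda>n s. poly (Q n) (of_real s)) (\<lambda>s. of_real (g s)) sequentially"
     "(\<lambda>n. op_poly h (Q n)) \<longlonglongrightarrow> y" using assms(2) unfolding fcalc_def by blast
  have b: "bounded ((\<lambda>s. complex_of_real (k s)) ` {0..1})" if "continuous_on {0..1} k" for k :: "real \<Rightarrow> real"
    by (intro compact_imp_bounded compact_continuous_image continuous_intros that) simp
  have "uniform_limit {0..1} (\<lambda>n s. poly (P n * Q n) (of_real s)) (\<lambda>s. of_real (f s * g s)) sequentially"
    unfolding poly_mult of_real_mult by (rule uniform_lim_mult[OF P(2) Q(2) b b]) (rule cont)+
  moreover have "is_adjoint (op_poly h (P n * Q n)) (op_poly h (P n * Q n))" for n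
    using is_adjoint_mult[OF P(1)[of n] Q(1)[of n]] by (metis op_poly_mult mult.commute)
  ultimately show ?thesis
    using tendsto_mult[OF P(3) Q(3)]
    unfolding fcalc_def by (intro exI[of _ "\<lambda>n. P n * Q n"]) (auto simp: op_poly_mult)
qed

lemma fcalc_unique:
  assumes "fcalc f x" "fcalc g y" and eq: "\<And>s. 0 \<le> s \<Longrightarrow> s \<le> 1 \<Longrightarrow> f s = g s"
  shows "x = y"
proof -
  obtain P where P: "\<And>n. is_adjoint (op_poly h (P n)) (op_poly h (P n))"
     "uniform_limit {0..1} (\<lambda>n s. poly (P n) (of_real s)) (\<lambda>s. of_real (f s)) sequentially"
     "(\<lambda>n. op_poly h (P n)) \<longlonglongrightarrow> x" using assms(1) unfolding fcalc_def by blast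
  obtain Q where Q: "\<And>n. is_adjoint (op_poly h (Q n)) (op_poly h (Q n))"
     "uniform_limit {0..1} (\<lambda>n s. poly (Q n) (of_real s)) (\<lambda>s. of_real (g s)) sequentially"
     "(\<lambda>n. op_poly h (Q n)) \<longlonglongrightarrow> y" using assms(2) unfolding fcalc_def by blast
  have "uniform_limit {0..1} (\<lambda>n s. poly (P n - Q n) (of_real s)) (\<lambda>s. of_real (f s) - of_real (g s)) sequentially"
    unfolding poly_diff by (rule uniform_limit_minus[OF P(2) Q(2)])
  then have unif: "\<forall>\<^sub>F n in sequentially. \<forall>s\<in>{0..1}. cmod (poly (P n - Q n) (of_real s)) < e" if "e > 0" for e
    using uniform_limitD[OF _ that] eq by fastforce
  have "(\<lambda>n. op_poly h (P n - Q n)) \<longlonglongrightarrow> 0"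
  proof (rule tendstoI)
    fix e :: real assume "e > 0"
    then have "e / 2 > 0" by simp
    from unif[OF this] show "\<forall>\<^sub>F n in sequentially. dist (op_poly h (P n - Q n)) 0 < e"
    proof eventually_elim
      case (elim n)
      have "norm (op_poly h (P n - Q n)) \<le> e / 2"
        using elim P(1) Q(1) by (intro norm_op_poly_le) (auto simp only: op_poly_diff atLeastAtMost_iff intro!: is_adjoint_diff less_imp_le)
      then show ?case using \<open>e > 0\<close> by simp
    qed
  qed
  moreover have "(\<lambda>n. op_poly h (P n - Q n)) \<longlonglongrightarrow> x - y"
    unfolding op_poly_diff by (rule tendsto_diff[OF P(3) Q(3)])
  ultimately have "x - y = 0" by (rule LIMSEQ_unique[rotated])
  then show ?thesis by simp
qed

lemma real_polynomial_function_op_poly: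
  fixes g :: "real \<Rightarrow> real"
  assumes "real_polynomial_function g"
  shows "\<exists>p. is_adjoint (op_poly h p) (op_poly h p) \<and> (\<forall>s. poly p (of_real s) = of_real (g s))"
  using assms
proof (induction rule: real_polynomial_function.induct)
  case (linear f)
  then obtain c where "f = (\<lambda>s. s * c)" by (auto simp: real_bounded_linear)
  then show ?case
    using is_adjoint_scaleR[OF selfadjoint, of c]
    by (intro exI[of _ "smult (of_real c) [:0, 1:]"])
      (auto simp: op_poly_smult scaleC_bop_one scaleC_bop_zero_scalar scaleR_bop_scaleC scaleC_bop_mult_right)
next
  case (const c)
  then show ?case
    using is_adjoint_scaleR[OF is_adjoint_one, of c]
    by (intro exI[of _ "[:of_real c:]"]) (auto simp: scaleR_bop_scaleC)
next
  case (add f g)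
  then obtain p q where "is_adjoint (op_poly h p) (op_poly h p)" "\<forall>s. poly p (of_real s) = of_real (f s)"
    "is_adjoint (op_poly h q) (op_poly h q)" "\<forall>s. poly q (of_real s) = of_real (g s)" by blast
  then show ?case
    by (intro exI[of _ "p + q"]) (simp add: op_poly_add is_adjoint_add)
next
  case (mult f g)
  then obtain p q where p: "is_adjoint (op_poly h p) (op_poly h p)" "\<forall>s. poly p (of_real s) = of_real (f s)"
    and q: "is_adjoint (op_poly h q) (op_poly h q)" "\<forall>s. poly q (of_real s) = of_real (g s)" by blast
  have "op_poly h q * op_poly h p = op_poly h p * op_poly h q"
    by (simp only: op_poly_mult[symmetric] mult.commute)
  then show ?case
    using p q is_adjoint_mult[OF p(1) q(1)] by (intro exI[of _ "p * q"]) (simp add: op_poly_mult)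
qed

lemma fcalc_exists:
  assumes "continuous_on {0..1} f"
  shows "\<exists>x. fcalc f x"
proof -
  have "\<exists>p. is_adjoint (op_poly h p) (op_poly h p) \<and>
      (\<forall>s\<in>{0..1}. cmod (poly p (of_real s) - of_real (f s)) < inverse (Suc n))" for n
  proof -
    obtain g where g: "real_polynomial_function g" "\<And>s. s \<in> {0..1} \<Longrightarrow> \<bar>f s - g s\<bar> < inverse (Suc n)"
      using Stone_Weierstrass_real_polynomial_function[of "{0..1}" f "inverse (Suc n)"] assms by auto
    obtain p where p: "is_adjoint (op_poly h p) (op_poly h p)" "\<And>s. poly p (of_real s) = of_real (g s)"
      using real_polynomial_function_op_poly[OF g(1)] by auto
    have "cmod (poly p (of_real s) - of_real (f s)) < inverse (Suc n)" if "s \<in> {0..1}" for s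
      using g(2)[OF that] unfolding p(2) of_real_diff[symmetric] norm_of_real by linarith
    with p(1) show ?thesis by blast
  qed
  then obtain P where P: "\<And>n. is_adjoint (op_poly h (P n)) (op_poly h (P n))"
    "\<And>n s. s \<in> {0..1} \<Longrightarrow> cmod (poly (P n) (of_real s) - of_real (f s)) < inverse (Suc n)"
    by metis
  have unif: "uniform_limit {0..1} (\<lambda>n s. poly (P n) (of_real s)) (\<lambda>s. of_real (f s)) sequentially"
  proof (rule uniform_limitI)
    fix e :: real assume "e > 0"
    then obtain N where "inverse (Suc N) < e" using reals_Archimedean by auto
    then have "inverse (Suc n) < e" if "n \<ge> N" for n
      using that by (smt (verit) Suc_le_mono inverse_le_imp_le le_imp_inverse_le of_nat_0_less_iff of_nat_mono zero_less_Suc)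
    then show "\<forall>\<^sub>F n in sequentially. \<forall>s\<in>{0..1}. dist (poly (P n) (of_real s)) (of_real (f s)) < e"
      unfolding eventually_sequentially dist_norm by (intro exI[of _ N]) (meson P(2) less_trans)
  qed
  have "Cauchy (\<lambda>n. op_poly h (P n))"
  proof (rule CauchyI)
    fix e :: real assume "e > 0"
    then have "e / 4 > 0" by simp
    then obtain N where N: "\<And>n s. n \<ge> N \<Longrightarrow> s \<in> {0..1} \<Longrightarrow> cmod (poly (P n) (of_real s) - of_real (f s)) < e / 4"
      using uniform_limitD[OF unif] unfolding eventually_sequentially dist_norm by meson
    have "norm (op_poly h (P m) - op_poly h (P n)) < e" if "m \<ge> N" "n \<ge> N" for m n
    proof -
      have "cmod (poly (P m - P n) (of_real s)) \<le> e / 2" if "0 \<le> s" "s \<le> 1" for s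
      proof -
        have "cmod (poly (P m - P n) (of_real s)) \<le>
            cmod (poly (P m) (of_real s) - of_real (f s)) + cmod (poly (P n) (of_real s) - of_real (f s))"
          using norm_triangle_ineq4[of "poly (P m) (of_real s) - of_real (f s)" "poly (P n) (of_real s) - of_real (f s)"]
          by simp
        with N[OF \<open>m \<ge> N\<close>, of s] N[OF \<open>n \<ge> N\<close>, of s] that show ?thesis by auto
      qed
      then have "norm (op_poly h (P m - P n)) \<le> e / 2"
        by (intro norm_op_poly_le) (auto simp only: op_poly_diff intro!: is_adjoint_diff P(1))
      then show ?thesis using \<open>e > 0\<close> by (simp add: op_poly_diff)
    qed
    then show "\<exists>N. \<forall>m\<ge>N. \<forall>n\<ge>N. norm (op_poly h (P m) - op_poly h (P n)) < e" by blast
  qed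
  then obtain x where "(\<lambda>n. op_poly h (P n)) \<longlonglongrightarrow> x"
    by (auto simp: Cauchy_convergent_iff convergent_def)
  with P unif show ?thesis unfolding fcalc_def by blast
qed

end

section \<open>A criterion for density of the invertible elements\<close>

text \<open>The familiar fact that \<open>xy\<close> and \<open>yx\<close> have the same nonzero spectrum, with the inverse
  \<open>e\<^sup>-\<^sup>1 (1 - x (e + yx)\<^sup>-\<^sup>1 y)\<close> of \<open>e + xy\<close>.\<close>

lemma (in unital_cstar_algebra) units_swap:
  assumes x: "x \<in> A" and y: "y \<in> A" and "e \<noteq> 0" and unit: "e *\<^sub>R 1 + y * x \<in> units"
  shows "e *\<^sub>R 1 + x * y \<in> units"
proof -
  obtain g where g: "g \<in> A" "(e *\<^sub>R 1 + y * x) * g = 1" "g * (e *\<^sub>R 1 + y * x) = 1"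
    by (rule units_E[OF unit])
  have g1: "y * x * g = 1 - e *\<^sub>R g" and g2: "g * (y * x) = 1 - e *\<^sub>R g"
    using g(2,3) by (simp_all add: distrib_left distrib_right eq_diff_eq add.commute)
  have "(e *\<^sub>R 1 + x * y) * (1 - x * g * y) = e *\<^sub>R 1 + x * y - e *\<^sub>R (x * g * y) - x * (y * x * g) * y"
    by (simp add: algebra_simps)
  moreover have "(1 - x * g * y) * (e *\<^sub>R 1 + x * y) = e *\<^sub>R 1 + x * y - e *\<^sub>R (x * g * y) - x * (g * (y * x)) * y"
    by (simp add: algebra_simps)
  moreover have "x * (y * x * g) * y = x * y - e *\<^sub>R (x * g * y)" "x * (g * (y * x)) * y = x * y - e *\<^sub>R (x * g * y)"
    unfolding g1 g2 by (simp_all add: left_diff_distrib right_diff_distrib)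
  ultimately have "(e *\<^sub>R 1 + x * y) * (1 - x * g * y) = e *\<^sub>R 1" "(1 - x * g * y) * (e *\<^sub>R 1 + x * y) = e *\<^sub>R 1"
    by simp_all
  then show ?thesis
    using \<open>e \<noteq> 0\<close> x y g(1)
    by (intro units_I[of _ "inverse e *\<^sub>R (1 - x * g * y)"])
      (auto intro: scaleR_closed diff_closed add_closed mult_closed one_closed)
qed

text \<open>The vector state of \<open>\<delta>\<close> is a faithful trace: the last assumption is \<open>\<tau>(xx\<^sup>*) = \<tau>(x\<^sup>*x)\<close>.\<close>

locale tracial_cstar_algebra = unital_cstar_algebra +
  fixes \<delta>
  assumes norm_\<delta>: "norm \<delta> = 1"
    and faithful: "x \<in> A \<Longrightarrow> x \<cdot> \<delta> = 0 \<Longrightarrow> x = 0"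
    and tracial: "x \<in> A \<Longrightarrow> is_adjoint x x' \<Longrightarrow> norm (x' \<cdot> \<delta>) = norm (x \<cdot> \<delta>)"
begin

text \<open>Finiteness: the trace of the projection \<open>1 - uu\<^sup>*\<close> is \<open>\<parallel>\<delta>\<parallel>\<^sup>2 - \<parallel>u\<^sup>*\<delta>\<parallel>\<^sup>2 = \<parallel>\<delta>\<parallel>\<^sup>2 - \<parallel>u\<delta>\<parallel>\<^sup>2 = 0\<close>.\<close>

lemma isometry_is_unitary:
  assumes u: "u \<in> A" and adj: "is_adjoint u u'" and iso: "u' * u = 1"
  shows "u * u' = 1"
proof -
  have uu: "u' \<cdot> u \<cdot> \<xi> = \<xi>" for \<xi>
    using arg_cong[OF iso, of "\<lambda>v. v \<cdot> \<xi>"] by simp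
  have isom: "norm (u \<cdot> \<xi>) = norm \<xi>" for \<xi>
    by (simp add: norm_eq_sqrt_inner is_adjointD[OF adj] uu)
  have "norm (u' \<cdot> \<delta>) = 1"
    using tracial[OF u adj] isom norm_\<delta> by simp
  moreover have "(u \<cdot> u' \<cdot> \<delta>) \<bullet> \<delta> = (norm (u' \<cdot> \<delta>))\<^sup>2"
    by (simp add: is_adjointD[OF adj] power2_norm_eq_inner)
  ultimately have "(norm ((1 - u * u') \<cdot> \<delta>))\<^sup>2 = 0"
    by (simp add: norm_diff_square isom norm_\<delta>)
  then have "1 - u * u' = 0"
    by (intro faithful diff_closed one_closed mult_closed u adjoint_closed[OF u adj]) simp_all
  then show ?thesis by simp
qed

text \<open>The bound \<open>\<parallel>b - c\<parallel> < t\<close> is sharp enough to make \<open>F c\<^sup>* b F\<close> accretive because \<open>b\<close> is \<open>t\<close> times an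
  isometry on the range of \<open>F\<close>: there \<open>2 Re \<langle>b\<eta>, c\<eta>\<rangle> = \<parallel>b\<eta>\<parallel>\<^sup>2 + \<parallel>c\<eta>\<parallel>\<^sup>2 - \<parallel>(b - c)\<eta>\<parallel>\<^sup>2 \<ge> 0\<close>. The operator
  \<open>Y\<close> is the defect of this isometry, \<open>b\<^sup>*b + Y\<^sup>2 = t\<^sup>2\<close>.\<close>

lemma contraction_near_units:
  assumes approx: "\<And>b \<eta>. b \<in> A \<Longrightarrow> \<eta> > 0 \<Longrightarrow> \<exists>c\<in>units. norm (b - c) < norm (b \<cdot> \<delta>) + \<eta>"
    and a: "a \<in> A" "norm a \<le> 1" and t: "t > 0" and "\<epsilon> > 0"
  shows "\<exists>d\<in>units. norm (a - d) \<le> t + \<epsilon>"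
proof -
  obtain a' where a': "is_adjoint a a'" using adjoint_exists[OF a(1)] by auto
  have a'_closed: "a' \<in> A" by (rule adjoint_closed[OF a(1) a'])
  define h where "h = a' * a"
  interpret positive_contraction A h
  proof
    show "h \<in> A" unfolding h_def by (intro mult_closed a'_closed a)
    show "is_adjoint h h" unfolding h_def by (rule is_adjoint_mult[OF is_adjoint_sym[OF a'] a'])
    have h: "(h \<cdot> \<xi>) \<bullet> \<xi> = (norm (a \<cdot> \<xi>))\<^sup>2" for \<xi>
      by (simp add: h_def is_adjointD[OF is_adjoint_sym[OF a']] power2_norm_eq_inner)
    show "0 \<le> (h \<cdot> \<xi>) \<bullet> \<xi>" for \<xi> unfolding h by simp
    have "norm (a \<cdot> \<xi>) \<le> norm \<xi>" for \<xi>
      using norm_bop_apply_le[of a \<xi>] mult_right_mono[OF a(2) norm_ge_zero[of \<xi>]] by simp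
    then show "(h \<cdot> \<xi>) \<bullet> \<xi> \<le> (norm \<xi>)\<^sup>2" for \<xi> unfolding h by (simp add: power_mono)
  qed
  \<comment> \<open>for the polar decomposition \<open>a = v\<bar>a\<bar>\<close>, these functions of \<open>\<bar>a\<bar>\<^sup>2\<close> give \<open>b = v min(\<bar>a\<bar>, t)\<close>
    and \<open>b F\<^sup>2 = v (\<bar>a\<bar> - t)\<^sub>+\<close>\<close>
  define m q f y where "m s = max (sqrt s) t" and "q s = t / m s" and "f s = sqrt (m s / t - 1)"
    and "y s = sqrt (t\<^sup>2 - q s * s * q s)" for s
  have m: "m s \<ge> t" "m s > 0" for s using t by (auto simp: m_def)
  have cont_m: "continuous_on {0..1} m" unfolding m_def by (intro continuous_intros)
  have cont_q: "continuous_on {0..1} q"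
    unfolding q_def using m(2) by (intro continuous_intros cont_m) (metis less_irrefl)
  have cont_f: "continuous_on {0..1} f"
    unfolding f_def using t by (intro continuous_intros cont_m) auto
  have cont_y: "continuous_on {0..1} y"
    unfolding y_def by (intro continuous_intros cont_q)
  have qsq: "q s * s * q s \<le> t\<^sup>2" if "0 \<le> s" for s
  proof -
    have "s \<le> (m s)\<^sup>2" using that by (metis m_def max.cobounded1 power_mono real_sqrt_ge_zero real_sqrt_pow2)
    then have "(t / m s)\<^sup>2 * s \<le> (t / m s)\<^sup>2 * (m s)\<^sup>2" by (intro mult_left_mono) auto
    also have "\<dots> = t\<^sup>2" using m(2)[of s] by (simp add: power_divide)
    finally show ?thesis by (simp add: q_def power2_eq_square mult_ac)
  qed
  have eq1: "q s * s * q s + y s * y s = t\<^sup>2" if "0 \<le> s" for s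
    using qsq[OF that] by (simp add: y_def)
  have eq2: "y s * f s = 0" if "0 \<le> s" for s
  proof (cases "sqrt s \<le> t")
    case True
    then show ?thesis using t by (simp add: f_def m_def max_absorb2)
  next
    case False
    then have "m s = sqrt s" "s > 0" using t that by (auto simp: m_def intro: ccontr)
    then have "q s * s * q s = t\<^sup>2" by (simp add: q_def power2_eq_square)
    then show ?thesis by (simp add: y_def)
  qed
  have eq3: "q s * (1 + f s * f s) = 1" for s
    using m[of s] t by (simp add: q_def f_def)
  obtain Q where Q: "fcalc q Q" using fcalc_exists[OF cont_q] by auto
  obtain F where F: "fcalc f F" using fcalc_exists[OF cont_f] by auto
  obtain Y where Y: "fcalc y Y" using fcalc_exists[OF cont_y] by auto
  note closed = fcalc_closed[OF Q] fcalc_closed[OF F] fcalc_closed[OF Y]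
  note adj = fcalc_selfadjoint[OF Q] fcalc_selfadjoint[OF F] fcalc_selfadjoint[OF Y]
  note cont = cont_q cont_f cont_y continuous_on_id continuous_on_const continuous_on_mult continuous_on_add
  have one: "fcalc (\<lambda>_. 1) 1" using fcalc_const[of 1] by simp
  have QhQ: "Q * h * Q + Y * Y = t\<^sup>2 *\<^sub>R 1"
    by (rule fcalc_unique[OF fcalc_add[OF fcalc_mult[OF fcalc_mult[OF Q fcalc_id] Q] fcalc_mult[OF Y Y]] fcalc_const[of "t\<^sup>2"]])
      (intro cont | simp add: eq1)+
  have YF: "Y * F = 0"
    by (rule fcalc_unique[OF fcalc_mult[OF Y F] fcalc_const[of 0, unfolded scaleR_zero_left]])
      (intro cont | simp add: eq2)+
  have QF: "Q * (1 + F * F) = 1"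
    by (rule fcalc_unique[OF fcalc_mult[OF Q fcalc_add[OF one fcalc_mult[OF F F]]] one])
      (intro cont | simp add: eq3)+
  have FQ: "(1 + F * F) * Q = 1"
    by (rule fcalc_unique[OF fcalc_mult[OF fcalc_add[OF one fcalc_mult[OF F F]] Q] one])
      (intro cont | simp add: eq3 mult.commute)+
  define b b' where "b = a * Q" and "b' = Q * a'"
  have b: "b \<in> A" unfolding b_def by (intro mult_closed a closed)
  have b': "is_adjoint b b'" unfolding b_def b'_def by (intro is_adjoint_mult a' adj)
  have "b' * b = Q * h * Q" by (simp add: b_def b'_def h_def mult.assoc)
  then have bb: "b' * b = t\<^sup>2 *\<^sub>R 1 - Y * Y" using QhQ by (simp add: eq_diff_eq)
  have norm_b: "(norm (b \<cdot> \<xi>))\<^sup>2 = t\<^sup>2 * (norm \<xi>)\<^sup>2 - (norm (Y \<cdot> \<xi>))\<^sup>2" for \<xi>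
  proof -
    have "(norm (b \<cdot> \<xi>))\<^sup>2 = \<xi> \<bullet> ((b' * b) \<cdot> \<xi>)"
      by (simp add: power2_norm_eq_inner is_adjointD[OF b'])
    also have "\<dots> = t\<^sup>2 * (norm \<xi>)\<^sup>2 - \<xi> \<bullet> (Y \<cdot> Y \<cdot> \<xi>)"
      unfolding bb by (simp add: inner_diff_right power2_norm_eq_inner)
    also have "\<xi> \<bullet> (Y \<cdot> Y \<cdot> \<xi>) = (norm (Y \<cdot> \<xi>))\<^sup>2"
      by (simp add: power2_norm_eq_inner is_adjointD[OF adj(3)])
    finally show ?thesis .
  qed
  have a_b: "a = b * (1 + F * F)" by (simp add: b_def mult.assoc QF)
  show ?thesis
  proof (cases "Y \<cdot> \<delta> = 0")
    case True
    then have "Y = 0" by (intro faithful closed)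
    define u u' where "u = inverse t *\<^sub>R b" and "u' = inverse t *\<^sub>R b'"
    have u: "u \<in> A" "is_adjoint u u'"
      unfolding u_def u'_def by (intro scaleR_closed b is_adjoint_scaleR b')+
    have "inverse t * (inverse t * t\<^sup>2) = 1" using t by (simp add: power2_eq_square field_simps)
    then have "u' * u = 1" by (simp add: u_def u'_def bb \<open>Y = 0\<close>)
    then have "u \<in> units"
      using isometry_is_unitary[OF u] adjoint_closed[OF u] u by (intro units_I[of u u'])
    then have "t *\<^sub>R u \<in> units" using t by (intro units_scaleR) auto
    then have "b \<in> units" using t by (simp add: u_def)
    moreover have "1 + F * F \<in> units"
      using FQ QF by (intro units_I[of _ Q] add_closed one_closed mult_closed closed)
    ultimately have "a \<in> units" unfolding a_b by (rule units_mult)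
    then show ?thesis using t \<open>\<epsilon> > 0\<close> by (intro bexI[of _ a]) auto
  next
    case False
    have "(norm (b \<cdot> \<delta>))\<^sup>2 < t\<^sup>2" using False by (simp add: norm_b norm_\<delta>)
    then have "norm (b \<cdot> \<delta>) < t" using t by (simp add: power_less_imp_less_base)
    then obtain c where c: "c \<in> units" "norm (b - c) < t"
      using approx[OF b, of "t - norm (b \<cdot> \<delta>)"] by auto
    have c_closed: "c \<in> A" by (rule units_E[OF c(1)])
    obtain c' where c': "is_adjoint c c'" using adjoint_exists[OF c_closed] by auto
    have c'_closed: "c' \<in> A" by (rule adjoint_closed[OF c_closed c'])
    obtain d where d: "d \<in> A" "c' * d = 1" "d * c' = 1" by (rule units_E[OF units_adjoint[OF c(1) c']])
    define e where "e = \<epsilon> / (norm d + 1)"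
    have e: "e > 0" using \<open>\<epsilon> > 0\<close> by (simp add: e_def add_nonneg_pos)
    have "e *\<^sub>R 1 + F * (c' * b * F) \<in> units"
    proof (rule accretive_in_units[OF _ e])
      show "e *\<^sub>R 1 + F * (c' * b * F) \<in> A"
        by (intro add_closed scaleR_closed one_closed mult_closed closed c'_closed b)
      fix \<xi>
      define \<eta> where "\<eta> = F \<cdot> \<xi>"
      have "Y \<cdot> \<eta> = 0" using arg_cong[OF YF, of "\<lambda>u. u \<cdot> \<xi>"] by (simp add: \<eta>_def)
      then have "(norm (b \<cdot> \<eta>))\<^sup>2 = t\<^sup>2 * (norm \<eta>)\<^sup>2" by (simp add: norm_b)
      moreover have "norm ((b - c) \<cdot> \<eta>) \<le> t * norm \<eta>"
        using norm_bop_apply_le[of "b - c" \<eta>] mult_right_mono[OF less_imp_le[OF c(2)] norm_ge_zero[of \<eta>]]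
        by linarith
      then have "(norm ((b - c) \<cdot> \<eta>))\<^sup>2 \<le> t\<^sup>2 * (norm \<eta>)\<^sup>2"
        by (metis norm_ge_zero power_mono power_mult_distrib)
      moreover have "(norm ((b - c) \<cdot> \<eta>))\<^sup>2 =
          (norm (b \<cdot> \<eta>))\<^sup>2 - 2 * ((c \<cdot> \<eta>) \<bullet> (b \<cdot> \<eta>)) + (norm (c \<cdot> \<eta>))\<^sup>2"
        by (simp add: norm_diff_square)
      ultimately have "0 \<le> (c \<cdot> \<eta>) \<bullet> (b \<cdot> \<eta>)"
        using zero_le_power2[of "norm (c \<cdot> \<eta>)"] by linarith
      also have "(c \<cdot> \<eta>) \<bullet> (b \<cdot> \<eta>) = (F \<cdot> c' \<cdot> b \<cdot> F \<cdot> \<xi>) \<bullet> \<xi>"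
        by (simp add: \<eta>_def is_adjointD[OF adj(2)] is_adjointD[OF is_adjoint_sym[OF c']])
          (rule inner_commute)
      finally show "e * (norm \<xi>)\<^sup>2 \<le> ((e *\<^sub>R 1 + F * (c' * b * F)) \<cdot> \<xi>) \<bullet> \<xi>"
        by (simp add: inner_add_left power2_norm_eq_inner)
    qed
    then have "e *\<^sub>R 1 + c' * b * F * F \<in> units"
      by (rule units_swap[rotated 3]) (use e in \<open>auto intro!: mult_closed closed c'_closed b\<close>)
    moreover have "d \<in> units" using d c'_closed by (intro units_I[of d c'])
    ultimately have "d * (e *\<^sub>R 1 + c' * b * F * F) \<in> units" by (rule units_mult[rotated])
    also have "d * (e *\<^sub>R 1 + c' * b * F * F) = e *\<^sub>R d + (d * c') * b * F * F"
      by (simp add: distrib_left mult.assoc)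
    also have "\<dots> = e *\<^sub>R d + b * F * F" using d by simp
    finally have unit: "e *\<^sub>R d + b * F * F \<in> units" .
    have "norm b \<le> t"
    proof (rule norm_bop_le)
      fix \<xi>
      have "(norm (b \<cdot> \<xi>))\<^sup>2 \<le> (t * norm \<xi>)\<^sup>2" by (simp add: norm_b power_mult_distrib)
      then show "norm (b \<cdot> \<xi>) \<le> t * norm \<xi>" by (rule power2_le_imp_le) (use t in simp)
    qed (use t in simp)
    moreover have diff: "a - (e *\<^sub>R d + b * F * F) = b - e *\<^sub>R d"
      by (subst a_b) (simp add: distrib_left mult.assoc)
    moreover have "norm (b - e *\<^sub>R d) \<le> norm b + e * norm d"
      using norm_triangle_ineq4[of b "e *\<^sub>R d"] e by simp
    moreover have "e * norm d \<le> \<epsilon>"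
      using \<open>\<epsilon> > 0\<close> by (simp add: e_def pos_divide_le_eq add_nonneg_pos)
    ultimately have "norm (a - (e *\<^sub>R d + b * F * F)) \<le> t + \<epsilon>"
      unfolding diff by linarith
    with unit show ?thesis by blast
  qed
qed

theorem stable_rank_one_if_near_units:
  assumes "\<And>b \<eta>. b \<in> A \<Longrightarrow> \<eta> > 0 \<Longrightarrow> \<exists>c\<in>units. norm (b - c) < norm (b \<cdot> \<delta>) + \<eta>"
  shows "stable_rank_one A"
  unfolding stable_rank_one_def
proof
  fix a assume a: "a \<in> A"
  show "a \<in> closure units"
    unfolding closure_approachable
  proof (intro allI impI)
    fix e :: real assume "e > 0"
    define K where "K = norm a + 1"
    have K: "K > 0" by (simp add: K_def add_nonneg_pos)
    define t where "t = e / (4 * K)"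
    have t: "t > 0" using \<open>e > 0\<close> K by (simp add: t_def)
    have "norm (inverse K *\<^sub>R a) \<le> 1" using K by (simp add: K_def field_simps)
    then obtain d where d: "d \<in> units" "norm (inverse K *\<^sub>R a - d) \<le> t + t"
      using contraction_near_units[OF assms scaleR_closed[OF a] _ t t] by metis
    have "a - K *\<^sub>R d = K *\<^sub>R (inverse K *\<^sub>R a - d)"
      using K by (simp add: scaleR_diff_right)
    then have "norm (a - K *\<^sub>R d) = K * norm (inverse K *\<^sub>R a - d)"
      using K by simp
    also have "\<dots> \<le> K * (t + t)" using d(2) K by (intro mult_left_mono) auto
    also have "\<dots> < e" using K \<open>e > 0\<close> by (simp add: t_def)
    finally have "dist (K *\<^sub>R d) a < e" by (simp add: dist_norm norm_minus_commute)
    moreover have "K *\<^sub>R d \<in> units" using d K by (intro units_scaleR) auto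
    ultimately show "\<exists>y\<in>units. dist y a < e" by blast
  qed
qed

end

section \<open>The spectral radius formula\<close>

lemma power_scaleC_bop: "scaleC_bop c a ^ n = scaleC_bop (c ^ n) (a ^ n)"
  by (induction n) (simp_all add: scaleC_bop_one scaleC_bop_mult_left scaleC_bop_mult_right scaleC_bop_scaleC mult.commute)

lemma not_in_spectrum_if_power_bound:
  assumes bound: "\<And>n. norm (a ^ n) \<le> C * s ^ n" and s: "0 \<le> s" "s < cmod z"
  shows "z \<notin> spectrum a"
proof -
  define y where "y = scaleC_bop (inverse z) a"
  have z: "z \<noteq> 0" using s by auto
  have "summable (\<lambda>n. C * (s / cmod z) ^ n)"
    using s z by (intro summable_mult summable_geometric) simp
  then have "summable (\<lambda>n. y ^ n)"
  proof (rule summable_comparison_test[rotated], intro exI[of _ 0] allI impI)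
    fix n
    have "norm (y ^ n) = norm (a ^ n) / cmod z ^ n"
      by (simp add: y_def power_scaleC_bop norm_scaleC_bop norm_power norm_inverse divide_inverse power_inverse mult.commute)
    also have "\<dots> \<le> C * (s / cmod z) ^ n"
      using bound[of n] by (simp add: power_divide divide_right_mono)
    finally show "norm (y ^ n) \<le> C * (s / cmod z) ^ n" .
  qed
  note neumann[OF this]
  moreover have "scaleC_bop z 1 - a = scaleC_bop z (1 - y)"
    using z by (simp add: y_def scaleC_bop_diff scaleC_bop_scaleC scaleC_bop_one)
  ultimately have "(scaleC_bop z 1 - a) * scaleC_bop (inverse z) (\<Sum>n. y ^ n) = 1"
    "scaleC_bop (inverse z) (\<Sum>n. y ^ n) * (scaleC_bop z 1 - a) = 1"
    using z by (simp_all add: scaleC_bop_mult_left scaleC_bop_mult_right scaleC_bop_scaleC scaleC_bop_one)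
  then show ?thesis by (auto simp: spectrum_def invertible_elements_def)
qed

lemma spectrum_bounded: "bdd_above (cmod ` spectrum a)"
proof (rule bdd_aboveI2)
  fix z assume "z \<in> spectrum a"
  then show "cmod z \<le> norm a"
    using not_in_spectrum_if_power_bound[of a 1 "norm a" z] norm_power_ineq[of a] by force
qed

lemma not_in_spectrum_if_gt_spectral_radius: "spectral_radius a < cmod z \<Longrightarrow> z \<notin> spectrum a"
  unfolding spectral_radius_def using cSUP_upper[OF _ spectrum_bounded] by fastforce

lemma sum_powers_root_of_unity:
  assumes "j < n"
  shows "(\<Sum>k<n. exp (2 * of_real pi * \<i> * of_nat k / of_nat n) ^ j) = (if j = 0 then of_nat n else 0 :: complex)"
proof (cases "j = 0")
  case False
  define x where "x = exp (2 * of_real pi * \<i> * of_nat j / of_nat n)"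
  have "exp (2 * of_real pi * \<i> * of_nat k / of_nat n) ^ j = x ^ k" for k
    unfolding x_def exp_of_nat_mult[symmetric] by (simp add: mult_ac)
  moreover have "x \<noteq> 1"
    using complex_root_unity_eq_1[of n j] assms False by (auto simp: x_def dest: dvd_imp_le)
  moreover have "x ^ n = 1"
    using complex_root_unity[of n j] assms by (simp add: x_def)
  ultimately show ?thesis using False by (simp add: geometric_sum)
qed simp

text \<open>By the resolvent identity \<open>R w - R v = (w - v) (R w) a (R v)\<close>, the norm of \<open>R\<close> near \<open>v\<close> is at
  most twice its norm at \<open>v\<close>; a second use of the identity then gives continuity.\<close>

lemma resolvent_continuous:
  fixes a :: "'g bop"
  assumes R: "\<And>w. w \<in> K \<Longrightarrow> (1 - scaleC_bop w a) * R w = 1" "\<And>w. w \<in> K \<Longrightarrow> R w * (1 - scaleC_bop w a) = 1"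
  shows "continuous_on K R"
  unfolding continuous_on_iff
proof (intro ballI allI impI)
  fix v and e :: real assume v: "v \<in> K" and e: "e > 0"
  define M where "M = norm a * norm (R v) + 1"
  have M: "M \<ge> 1" "norm a * norm (R v) \<le> M" by (simp_all add: M_def)
  define d where "d = min (1 / (2 * M)) (e / (4 * M * (norm (R v) + 1)))"
  have d: "d > 0" using M e by (simp add: d_def add_nonneg_pos)
  have "dist (R w) (R v) < e" if w: "w \<in> K" and "dist w v < d" for w
  proof -
    have "R w - R v = R w * ((1 - scaleC_bop v a) * R v) - R w * (1 - scaleC_bop w a) * R v"
      using R v w by simp
    also have "\<dots> = scaleC_bop (w - v) (R w * a * R v)"
      using scaleC_bop_add_scalar[of w "- v" "R w * a * R v"]
      by (simp add: left_diff_distrib right_diff_distrib scaleC_bop_mult_left scaleC_bop_mult_right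
          mult.assoc scaleC_bop_minus_scalar)
    finally have diff: "R w - R v = scaleC_bop (w - v) (R w * a * R v)" .
    have "norm (R w * a * R v) \<le> norm (R w) * norm (a * R v)"
      by (simp only: mult.assoc norm_mult_ineq)
    also have "\<dots> \<le> norm (R w) * (norm a * norm (R v))"
      by (intro mult_left_mono norm_mult_ineq) simp
    also have "\<dots> \<le> norm (R w) * M" using M by (intro mult_left_mono) auto
    finally have le: "norm (R w - R v) \<le> cmod (w - v) * (norm (R w) * M)"
      unfolding diff norm_scaleC_bop by (intro mult_left_mono) auto
    have small: "cmod (w - v) \<le> 1 / (2 * M)" "cmod (w - v) < e / (4 * M * (norm (R v) + 1))"
      using \<open>dist w v < d\<close> by (simp_all add: d_def dist_norm)
    have "cmod (w - v) * (norm (R w) * M) \<le> 1 / (2 * M) * (norm (R w) * M)"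
      using small M by (intro mult_right_mono) auto
    also have "\<dots> = norm (R w) / 2" using M by simp
    finally have "norm (R w - R v) \<le> norm (R w) / 2" using le by simp
    then have Rw: "norm (R w) \<le> 2 * norm (R v)"
      using norm_triangle_ineq2[of "R w" "R v"] by simp
    have "cmod (w - v) * (norm (R w) * M) \<le> cmod (w - v) * (2 * (norm (R v) + 1) * M)"
      using Rw M by (intro mult_left_mono mult_right_mono) auto
    also have "\<dots> < e / (4 * M * (norm (R v) + 1)) * (2 * (norm (R v) + 1) * M)"
      using small M by (intro mult_strict_right_mono) (auto simp: add_nonneg_pos)
    also have "\<dots> = e / 2"
    proof -
      have "e / (4 * M * L) * (2 * L * M) = e / 2" if "L > 0" for L
        using that M by (simp add: field_simps)
      from this[of "norm (R v) + 1"] show ?thesis by (simp add: add_nonneg_pos)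
    qed
    finally have "norm (R w - R v) < e / 2" using le by simp
    then show ?thesis using e by (simp add: dist_norm)
  qed
  with d show "\<exists>d>0. \<forall>w\<in>K. dist w v < d \<longrightarrow> dist (R w) (R v) < e" by blast
qed

text \<open>Multiplied by \<open>1 - w\<^sup>na\<^sup>n\<close>, the \<open>k\<close>-th resolvent becomes the geometric sum of the powers of
  \<open>w\<omega>\<^sup>ka\<close>; in the average over \<open>k\<close> the orthogonality of the roots of unity leaves only the constant term.\<close>

lemma resolvent_average:
  fixes a :: "'g bop"
  assumes n: "n > 0"
    and R: "\<And>k. R k * (1 - scaleC_bop (w * exp (2 * of_real pi * \<i> * of_nat k / of_nat n)) a) = 1"
  shows "(inverse (real n) *\<^sub>R (\<Sum>k<n. R k)) * (1 - scaleC_bop (w ^ n) (a ^ n)) = 1"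
proof -
  define \<omega> where "\<omega> k = exp (2 * of_real pi * \<i> * of_nat k / of_nat n)" for k
  have root: "\<omega> k ^ n = 1" for k
    using complex_root_unity[of n k] n by (simp add: \<omega>_def)
  have "R k * (1 - scaleC_bop (w ^ n) (a ^ n)) = (\<Sum>j<n. scaleC_bop (\<omega> k ^ j) (scaleC_bop (w ^ j) (a ^ j)))" for k
  proof -
    let ?u = "scaleC_bop (w * \<omega> k) a"
    have "1 - scaleC_bop (w ^ n) (a ^ n) = (1 - ?u) * (\<Sum>j<n. ?u ^ j)"
      unfolding geometric_sum_left by (simp add: power_scaleC_bop power_mult_distrib root)
    then have "R k * (1 - scaleC_bop (w ^ n) (a ^ n)) = (R k * (1 - ?u)) * (\<Sum>j<n. ?u ^ j)"
      by (simp only: mult.assoc)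
    also have "\<dots> = (\<Sum>j<n. ?u ^ j)" using R[of k] by (simp add: \<omega>_def)
    finally show ?thesis by (simp add: power_scaleC_bop power_mult_distrib scaleC_bop_scaleC mult.commute)
  qed
  then have "(\<Sum>k<n. R k) * (1 - scaleC_bop (w ^ n) (a ^ n)) =
      (\<Sum>j<n. \<Sum>k<n. scaleC_bop (\<omega> k ^ j) (scaleC_bop (w ^ j) (a ^ j)))"
    by (simp only: sum_distrib_right) (rule sum.swap)
  also have "\<dots> = (\<Sum>j<n. scaleC_bop (\<Sum>k<n. \<omega> k ^ j) (scaleC_bop (w ^ j) (a ^ j)))"
  proof (rule sum.cong[OF refl])
    have "(\<Sum>k\<in>I. scaleC_bop (c k) b) = scaleC_bop (\<Sum>k\<in>I. c k) b" for I :: "nat set" and c and b :: "'g bop"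
      by (induction I rule: infinite_finite_induct) (simp_all add: scaleC_bop_zero_scalar scaleC_bop_add_scalar)
    then show "(\<Sum>k<n. scaleC_bop (\<omega> k ^ j) (scaleC_bop (w ^ j) (a ^ j))) =
        scaleC_bop (\<Sum>k<n. \<omega> k ^ j) (scaleC_bop (w ^ j) (a ^ j))" for j .
  qed
  also have "\<dots> = (\<Sum>j<n. if j = 0 then real n *\<^sub>R 1 else 0)"
    unfolding \<omega>_def
    by (intro sum.cong refl) (simp add: sum_powers_root_of_unity scaleC_bop_zero_scalar scaleC_bop_one scaleR_bop_scaleC)
  also have "\<dots> = real n *\<^sub>R 1" using n by simp
  finally show ?thesis using n by simp
qed

text \<open>The hard half of the spectral radius formula, by Rickart's argument. Where \<open>w\<^sup>na\<^sup>n \<longlonglongrightarrow> 0\<close>, the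
  averages \<open>(1 - w\<^sup>na\<^sup>n)\<^sup>-\<^sup>1\<close> of the resolvent tend to \<open>1\<close>; uniform continuity of the resolvent
  transports this, uniformly in \<open>n\<close>, to all \<open>w'\<close> within a fixed distance of \<open>w\<close>, where it gives
  boundedness of \<open>w'\<^sup>na\<^sup>n\<close>. Finitely many such steps lead from \<open>0\<close> to \<open>1/s\<close>.\<close>

lemma power_bound_if_not_in_spectrum:
  fixes a :: "'g bop"
  assumes s: "s > 0" and spec: "\<And>z. s \<le> cmod z \<Longrightarrow> z \<notin> spectrum a"
  shows "\<exists>C. \<forall>n. norm (a ^ n) \<le> C * s ^ n"
proof -
  define K where "K = cball (0::complex) (1 / s)"
  have "\<exists>r. (1 - scaleC_bop w a) * r = 1 \<and> r * (1 - scaleC_bop w a) = 1" if w: "w \<in> K" for w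
  proof (cases "w = 0")
    case False
    have "s * cmod w \<le> 1" using w s by (simp add: K_def pos_le_divide_eq mult.commute)
    then have "s \<le> inverse (cmod w)" using False by (simp add: field_simps)
    then have "s \<le> cmod (inverse w)" by (simp add: norm_inverse)
    then obtain r where r: "(scaleC_bop (inverse w) 1 - a) * r = 1" "r * (scaleC_bop (inverse w) 1 - a) = 1"
      using spec[of "inverse w"] by (auto simp: spectrum_def invertible_elements_def)
    have "1 - scaleC_bop w a = scaleC_bop w (scaleC_bop (inverse w) 1 - a)"
      using False by (simp add: scaleC_bop_diff scaleC_bop_scaleC scaleC_bop_one)
    with r False show ?thesis
      by (intro exI[of _ "scaleC_bop (inverse w) r"])
        (simp add: scaleC_bop_mult_left scaleC_bop_mult_right scaleC_bop_scaleC scaleC_bop_one)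
  qed (simp add: scaleC_bop_zero_scalar)
  then obtain R where R: "\<And>w. w \<in> K \<Longrightarrow> (1 - scaleC_bop w a) * R w = 1" "\<And>w. w \<in> K \<Longrightarrow> R w * (1 - scaleC_bop w a) = 1"
    by metis
  have "uniformly_continuous_on K R"
    by (rule compact_uniformly_continuous[OF resolvent_continuous[OF R]]) (simp_all add: K_def)
  then obtain d where d: "d > 0" "\<And>v w. v \<in> K \<Longrightarrow> w \<in> K \<Longrightarrow> dist w v < d \<Longrightarrow> dist (R w) (R v) < 1/4"
    unfolding uniformly_continuous_on_def by (metis zero_less_divide_1_iff zero_less_numeral)
  have step: "t ^ n * norm (a ^ n) \<le> 1"
    if n: "n > 0" and u: "0 \<le> u" "u \<le> 1 / s" and t: "0 \<le> t" "t \<le> 1 / s" and ut: "\<bar>t - u\<bar> < d"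
      and small: "u ^ n * norm (a ^ n) \<le> 1/5" for n u t
  proof -
    define \<omega> where "\<omega> k = exp (2 * of_real pi * \<i> * of_nat k / of_nat n)" for k
    have \<omega>: "cmod (\<omega> k) = 1" for k by (simp add: \<omega>_def norm_exp_eq_Re)
    have in_K: "of_real v * \<omega> k \<in> K" if "0 \<le> v" "v \<le> 1 / s" for v k
      using that \<omega> by (simp add: K_def norm_mult)
    define S where "S v = inverse (real n) *\<^sub>R (\<Sum>k<n. R (of_real v * \<omega> k))" for v
    have S: "S v * (1 - v ^ n *\<^sub>R a ^ n) = 1" if "0 \<le> v" "v \<le> 1 / s" for v
      using resolvent_average[OF n, of "\<lambda>k. R (of_real v * \<omega> k)" "of_real v" a] R(2)[OF in_K[OF that]]
      by (simp add: S_def \<omega>_def scaleR_bop_scaleC)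
    have "norm (S t - S u) \<le> inverse (real n) * (\<Sum>k<n. norm (R (of_real t * \<omega> k) - R (of_real u * \<omega> k)))"
      unfolding S_def scaleR_diff_right[symmetric] sum_subtractf[symmetric] norm_scaleR
      by (auto intro!: mult_left_mono norm_sum)
    also have "\<dots> \<le> inverse (real n) * (\<Sum>k<n. 1/4)"
    proof (intro mult_left_mono sum_mono)
      fix k
      have "dist (of_real t * \<omega> k) (of_real u * \<omega> k) = \<bar>t - u\<bar>"
        using \<omega>[of k] by (simp add: dist_norm left_diff_distrib[symmetric] norm_mult of_real_diff[symmetric] del: of_real_diff)
      then show "norm (R (of_real t * \<omega> k) - R (of_real u * \<omega> k)) \<le> 1/4"
        using d(2)[OF in_K[OF u] in_K[OF t], of k k] ut by (simp add: dist_norm)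
    qed simp
    also have "\<dots> = 1/4" using n by simp
    finally have near: "norm (S t - S u) \<le> 1/4" .
    have Su: "norm (S u - 1) \<le> 1/4"
    proof -
      have "S u - 1 = S u * (u ^ n *\<^sub>R a ^ n)" using S[OF u] by (simp add: right_diff_distrib diff_eq_eq add.commute)
      then have "norm (S u - 1) \<le> norm (S u) * norm (u ^ n *\<^sub>R a ^ n)" by (simp only: norm_mult_ineq)
      also have "\<dots> \<le> norm (S u) * (1/5)" using small u by (intro mult_left_mono) auto
      finally show ?thesis using norm_triangle_ineq2[of "S u" 1] by simp
    qed
    define v where "v = 1 - t ^ n *\<^sub>R a ^ n"
    have "v - 1 = (1 - S t) * v" using S[OF t] by (simp add: v_def left_diff_distrib)
    then have "norm (v - 1) \<le> norm (1 - S t) * norm v" by (simp only: norm_mult_ineq)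
    also have "\<dots> \<le> (1/2) * norm v"
    proof (rule mult_right_mono)
      show "norm (1 - S t) \<le> 1/2"
        using near Su norm_triangle_ineq[of "S t - S u" "S u - 1"] by (simp add: norm_minus_commute)
    qed simp
    finally have "norm (v - 1) \<le> 1" using norm_triangle_ineq2[of v 1] by simp
    then show ?thesis using t by (simp add: v_def)
  qed
  define \<tau> where "\<tau> k = min (1 / s) (real k * (d / 2))" for k
  have \<tau>: "0 \<le> \<tau> k" "\<tau> k \<le> 1 / s" for k using s d by (simp_all add: \<tau>_def)
  have \<tau>_Suc: "\<tau> k \<le> \<tau> (Suc k)" "\<tau> (Suc k) \<le> \<tau> k + d / 2" for k
    using d s by (auto simp: \<tau>_def min_def algebra_simps)
  have "\<exists>C. \<forall>n. \<tau> k ^ n * norm (a ^ n) \<le> C" for k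
  proof (induction k)
    case 0
    have "(0::real) ^ n * norm (a ^ n) \<le> 1" for n by (cases n) auto
    moreover have "\<tau> 0 = 0" using s by (simp add: \<tau>_def)
    ultimately show ?case by auto
  next
    case (Suc k)
    then obtain C where C: "\<tau> k ^ n * norm (a ^ n) \<le> C" for n by blast
    define u where "u = max 0 (\<tau> k - d / 4)"
    have u: "0 \<le> u" "u \<le> 1 / s" "\<bar>\<tau> (Suc k) - u\<bar> < d"
      using \<tau>[of k] \<tau>_Suc[of k] \<tau>[of "Suc k"] d s by (auto simp: u_def max_def)
    have "(\<lambda>n. u ^ n * norm (a ^ n)) \<longlonglongrightarrow> 0"
    proof (cases "u = 0")
      case True
      then show ?thesis
        by (intro tendsto_eventually eventually_sequentiallyI[of 1]) simp
    next
      case False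
      then have less: "0 < u" "u < \<tau> k" using d by (auto simp: u_def max_def split: if_splits)
      have lim: "(\<lambda>n. C * (u / \<tau> k) ^ n) \<longlonglongrightarrow> C * 0"
        using less by (intro tendsto_mult_left LIMSEQ_power_zero) simp
      have le: "norm (u ^ n * norm (a ^ n)) \<le> C * (u / \<tau> k) ^ n" for n
      proof -
        have "u ^ n * norm (a ^ n) = (u / \<tau> k) ^ n * (\<tau> k ^ n * norm (a ^ n))"
          using less by (simp add: power_divide)
        also have "\<dots> \<le> (u / \<tau> k) ^ n * C" using less C by (intro mult_left_mono) auto
        finally show ?thesis using less by (simp add: mult.commute)
      qed
      show ?thesis
        by (rule Lim_null_comparison[OF always_eventually[OF allI[OF le]] lim[unfolded mult_zero_right]])
    qed
    then have "\<forall>\<^sub>F n in sequentially. u ^ n * norm (a ^ n) < 1/5"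
      by (rule order_tendstoD) simp
    then obtain N where N: "\<And>n. n \<ge> N \<Longrightarrow> u ^ n * norm (a ^ n) < 1/5"
      by (auto simp: eventually_sequentially)
    define D where "D = 1 + (\<Sum>n\<le>N. \<tau> (Suc k) ^ n * norm (a ^ n))"
    have "\<tau> (Suc k) ^ n * norm (a ^ n) \<le> D" for n
    proof (cases "n \<le> N")
      case True
      then have "\<tau> (Suc k) ^ n * norm (a ^ n) \<le> (\<Sum>n\<le>N. \<tau> (Suc k) ^ n * norm (a ^ n))"
        using \<tau>[of "Suc k"] by (intro member_le_sum) auto
      then show ?thesis by (simp add: D_def)
    next
      case False
      then have "\<tau> (Suc k) ^ n * norm (a ^ n) \<le> 1"
      proof (intro step[OF _ u(1,2) \<tau> u(3)])
        show "0 < n" "u ^ n * norm (a ^ n) \<le> 1/5" using False N[of n] by linarith+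
      qed
      moreover have "0 \<le> (\<Sum>n\<le>N. \<tau> (Suc k) ^ n * norm (a ^ n))"
        using \<tau>[of "Suc k"] by (intro sum_nonneg) auto
      ultimately show ?thesis by (simp add: D_def)
    qed
    then show ?case by blast
  qed
  moreover obtain k where "1 / s / (d / 2) \<le> real k" using real_arch_simple by blast
  then have "1 / s \<le> real k * (d / 2)" using d by (simp only: pos_divide_le_eq half_gt_zero)
  then have "\<tau> k = 1 / s" unfolding \<tau>_def by (rule min_absorb1)
  ultimately obtain C where "(1 / s) ^ n * norm (a ^ n) \<le> C" for n by metis
  then have "norm (a ^ n) \<le> C * s ^ n" for n using s by (simp add: power_divide field_simps)
  then show ?thesis by blast
qed

text \<open>Otherwise \<open>\<parallel>a\<^sup>n\<parallel>\<close> would decay faster than every geometric sequence, while \<open>1 = a\<^sup>n(a\<^sup>-\<^sup>1)\<^sup>n\<close>.\<close>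

lemma spectrum_nonempty: "spectrum a \<noteq> {}"
proof
  assume empty: "spectrum a = {}"
  then have "0 \<notin> spectrum a" by simp
  then obtain b where "(scaleC_bop 0 1 - a) * b = 1"
    by (auto simp: spectrum_def invertible_elements_def)
  then have ab: "a * (- b) = 1" by (simp add: scaleC_bop_zero_scalar)
  have pow: "a ^ n * (- b) ^ n = 1" for n
  proof (induction n)
    case (Suc n)
    have "a ^ Suc n * (- b) ^ Suc n = a * (a ^ n * (- b) ^ n) * (- b)"
      by (simp only: power_Suc[of a] power_Suc2[of "- b"] mult.assoc)
    then show ?case using Suc ab by simp
  qed simp
  define s where "s = 1 / (2 * (norm b + 1))"
  have s: "s > 0" by (simp add: s_def add_nonneg_pos)
  have "norm b / (2 * (norm b + 1)) \<le> 1/2"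
    by (subst pos_divide_le_eq) (auto simp: add_nonneg_pos)
  then have sb: "s * norm b \<le> 1/2" by (simp add: s_def)
  obtain C where C: "\<And>n. norm (a ^ n) \<le> C * s ^ n"
    using power_bound_if_not_in_spectrum[OF s, of a] empty by auto
  have C0: "C \<ge> 0" using C[of 0] by simp
  have "1 \<le> C * (1/2) ^ n" for n
  proof -
    have "1 = norm (a ^ n * (- b) ^ n)" by (simp add: pow)
    also have "\<dots> \<le> norm (a ^ n) * norm ((- b) ^ n)" by (rule norm_mult_ineq)
    also have "\<dots> \<le> (C * s ^ n) * norm b ^ n"
      using C C0 s norm_power_ineq[of "- b" n] by (intro mult_mono) auto
    also have "\<dots> = C * (s * norm b) ^ n" by (simp add: power_mult_distrib)
    also have "\<dots> \<le> C * (1/2) ^ n" using C0 sb s by (intro mult_left_mono power_mono) auto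
    finally show ?thesis .
  qed
  moreover have "(\<lambda>n. C * (1/2) ^ n) \<longlonglongrightarrow> C * 0"
    by (intro tendsto_mult_left LIMSEQ_power_zero) simp
  ultimately have "1 \<le> C * 0" by (intro LIMSEQ_le_const) auto
  then show False by simp
qed

text \<open>Both halves of the spectral radius formula together, without mentioning the limit of
  \<open>\<parallel>a\<^sup>n\<parallel>\<^bsup>1/n\<^esup>\<close>. Nonemptiness of the spectrum enters because the supremum of the empty set of reals
  has no useful value.\<close>

lemma spectral_radius_le_if_powers_le:
  assumes "\<And>n. norm (a ^ n) \<le> norm (b ^ n)" "spectral_radius b \<le> r"
  shows "spectral_radius a \<le> r"
  unfolding spectral_radius_def
proof (rule cSUP_least[OF spectrum_nonempty])
  fix z assume z: "z \<in> spectrum a"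
  show "cmod z \<le> r"
  proof (rule ccontr)
    assume "\<not> cmod z \<le> r"
    define s where "s = (r + cmod z) / 2"
    have "r < s" "s < cmod z" using \<open>\<not> cmod z \<le> r\<close> by (simp_all add: s_def)
    have "0 \<le> r"
    proof -
      obtain y where "y \<in> spectrum b" using spectrum_nonempty by blast
      then have "cmod y \<le> spectral_radius b"
        unfolding spectral_radius_def by (rule cSUP_upper[OF _ spectrum_bounded])
      with assms(2) show ?thesis using norm_ge_zero[of y] by linarith
    qed
    then have "s > 0" using \<open>r < s\<close> by simp
    moreover have "y \<notin> spectrum b" if "s \<le> cmod y" for y
      using that \<open>r < s\<close> assms(2) by (intro not_in_spectrum_if_gt_spectral_radius) simp
    ultimately obtain C where "\<And>n. norm (b ^ n) \<le> C * s ^ n"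
      using power_bound_if_not_in_spectrum by metis
    then have "norm (a ^ n) \<le> C * s ^ n" for n using assms(1) order_trans by blast
    then have "z \<notin> spectrum a"
      using \<open>s > 0\<close> \<open>s < cmod z\<close> by (intro not_in_spectrum_if_power_bound) auto
    with z show False by simp
  qed
qed

section \<open>Twisted group algebras\<close>

locale twisted_group =
  fixes \<sigma> :: "'g::group_add \<Rightarrow> 'g \<Rightarrow> complex"
  assumes cocycle: "normalized_cocycle \<sigma>"
begin

lemma norm_\<sigma> [simp]: "cmod (\<sigma> g h) = 1"
  and \<sigma>_zero [simp]: "\<sigma> g 0 = 1" "\<sigma> 0 g = 1"
  and \<sigma>_cocycle: "\<sigma> g h * \<sigma> (g + h) k = \<sigma> h k * \<sigma> g (h + k)"
  using cocycle by (simp_all add: normalized_cocycle_def)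

lemma \<sigma>_nonzero [simp]: "\<sigma> g h \<noteq> 0"
  using norm_\<sigma>[of g h] by force

lemma Rep_lambda: "Rep_ell2 (lambda \<sigma> g \<cdot> \<xi>) h = \<sigma> g (- g + h) * Rep_ell2 \<xi> (- g + h)"
  by (rule lambda_apply) simp

lemma norm_lambda_apply: "norm (lambda \<sigma> g \<cdot> \<xi>) = norm \<xi>"
proof -
  have "Rep_ell2 (lambda \<sigma> g \<cdot> \<xi>) = twisted_shift \<sigma> g (Rep_ell2 \<xi>)"
    by (simp add: fun_eq_iff Rep_lambda twisted_shift_def)
  then show ?thesis
    by (simp add: norm_ell2.rep_eq twisted_shift_isometric(2))
qed

lemma lambda_mult: "lambda \<sigma> g * lambda \<sigma> h = scaleC_bop (\<sigma> g h) (lambda \<sigma> (g + h))"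
proof (rule bop_eqI, rule ell2_eqI)
  fix \<xi> x
  have "\<sigma> g h * \<sigma> (g + h) (- h + (- g + x)) = \<sigma> h (- h + (- g + x)) * \<sigma> g (- g + x)"
    using \<sigma>_cocycle[of g h "- h + (- g + x)"] by (simp only: add_minus_cancel)
  moreover have minus: "- (g + h) + x = - h + (- g + x)"
    by (simp only: minus_add add.assoc)
  ultimately show "Rep_ell2 ((lambda \<sigma> g * lambda \<sigma> h) \<cdot> \<xi>) x = Rep_ell2 (scaleC_bop (\<sigma> g h) (lambda \<sigma> (g + h)) \<cdot> \<xi>) x"
    using minus by (simp add: Rep_lambda scaleC_ell2.rep_eq mult_ac)
qed

lemma lambda_zero: "lambda \<sigma> 0 = 1"
  by (rule bop_eqI, rule ell2_eqI) (simp add: Rep_lambda)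

definition lambda_inv :: "'g \<Rightarrow> 'g bop" where
  "lambda_inv g = scaleC_bop (inverse (\<sigma> g (- g))) (lambda \<sigma> (- g))"

lemma lambda_lambda_inv: "lambda \<sigma> g * lambda_inv g = 1"
  by (simp add: lambda_inv_def scaleC_bop_mult_right lambda_mult scaleC_bop_scaleC lambda_zero scaleC_bop_one)

text \<open>A surjective isometry is unitary: it preserves inner products by polarization.\<close>

lemma is_adjoint_lambda: "is_adjoint (lambda \<sigma> g) (lambda_inv g)"
  unfolding is_adjoint_iff_inner
proof (intro allI)
  fix \<xi> \<eta>
  have polar: "(lambda \<sigma> g \<cdot> u) \<bullet> (lambda \<sigma> g \<cdot> v) = u \<bullet> v" for u v
    unfolding dot_norm bop_linear_simps(1)[symmetric] norm_lambda_apply ..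
  have "lambda \<sigma> g \<cdot> lambda_inv g \<cdot> \<eta> = \<eta>"
    using arg_cong[OF lambda_lambda_inv, of "\<lambda>u. u \<cdot> \<eta>"] by simp
  then show "(lambda \<sigma> g \<cdot> \<xi>) \<bullet> \<eta> = \<xi> \<bullet> (lambda_inv g \<cdot> \<eta>)"
    using polar[of \<xi> "lambda_inv g \<cdot> \<eta>"] by simp
qed

lemma lambda_inv_lambda: "lambda_inv g * lambda \<sigma> g = 1"
proof -
  have "lambda_inv g * lambda_inv (- g) = scaleC_bop (inverse (\<sigma> g (- g))) (lambda \<sigma> (- g) * lambda_inv (- g))"
    by (simp add: lambda_inv_def scaleC_bop_mult_left)
  then have inv: "lambda_inv g * lambda_inv (- g) = scaleC_bop (inverse (\<sigma> g (- g))) 1"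
    by (simp add: lambda_lambda_inv)
  have "lambda_inv (- g) = lambda \<sigma> g * (lambda_inv g * lambda_inv (- g))"
    by (simp add: mult.assoc[symmetric] lambda_lambda_inv)
  then have "scaleC_bop (\<sigma> g (- g)) (lambda_inv (- g)) = lambda \<sigma> g"
    unfolding inv by (simp add: scaleC_bop_mult_right scaleC_bop_scaleC scaleC_bop_one)
  then have "lambda_inv g * lambda \<sigma> g = scaleC_bop (\<sigma> g (- g)) (lambda_inv g * lambda_inv (- g))"
    by (metis scaleC_bop_mult_right)
  then show ?thesis unfolding inv by (simp add: scaleC_bop_scaleC scaleC_bop_one)
qed

lemma Lambda_superset:
  assumes "finite F" "supp f \<subseteq> F"
  shows "Lambda \<sigma> f = (\<Sum>g\<in>F. scaleC_bop (f g) (lambda \<sigma> g))"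
  unfolding Lambda_def using assms
  by (intro sum.mono_neutral_left) (auto simp: supp_def scaleC_bop_zero_scalar)

text \<open>For \<open>\<int>\<close> these are the trigonometric polynomials; in general they form a dense *-subalgebra.\<close>

definition polynomials :: "'g bop set" where
  "polynomials = Lambda \<sigma> ` Cc"

lemma polynomials_scaleC_lambda: "scaleC_bop c (lambda \<sigma> g) \<in> polynomials"
proof -
  let ?f = "\<lambda>h. if h = g then c else 0"
  have "supp ?f \<subseteq> {g}" by (auto simp: supp_def)
  then have "?f \<in> Cc" "Lambda \<sigma> ?f = scaleC_bop c (lambda \<sigma> g)"
    using Lambda_superset[of "{g}" ?f] by (auto simp: Cc_def intro: finite_subset)
  then show ?thesis unfolding polynomials_def by (metis image_eqI)
qed

lemma polynomials_add:
  assumes "x \<in> polynomials" "y \<in> polynomials" shows "x + y \<in> polynomials"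
proof -
  obtain f g where f: "x = Lambda \<sigma> f" "finite (supp f)" and g: "y = Lambda \<sigma> g" "finite (supp g)"
    using assms by (auto simp: polynomials_def Cc_def)
  let ?F = "supp f \<union> supp g" and ?k = "\<lambda>x. f x + g x"
  have F: "finite ?F" "supp ?k \<subseteq> ?F" using f g by (auto simp: supp_def)
  then have "Lambda \<sigma> ?k = x + y"
    by (simp add: f g Lambda_superset[of ?F] sum.distrib[symmetric] scaleC_bop_add_scalar)
  moreover have "?k \<in> Cc" using F by (auto simp: Cc_def intro: finite_subset)
  ultimately show ?thesis unfolding polynomials_def by (metis image_eqI)
qed

lemma polynomials_zero: "0 \<in> polynomials"
  using polynomials_scaleC_lambda[of 0] by (simp add: scaleC_bop_zero_scalar)

lemma polynomials_sum: "(\<And>i. i \<in> I \<Longrightarrow> x i \<in> polynomials) \<Longrightarrow> sum x I \<in> polynomials"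
  by (induction I rule: infinite_finite_induct) (auto intro: polynomials_zero polynomials_add)

lemma polynomials_E:
  assumes "x \<in> polynomials"
  obtains f where "finite (supp f)" "x = (\<Sum>g\<in>supp f. scaleC_bop (f g) (lambda \<sigma> g))"
  using assms by (auto simp: polynomials_def Cc_def Lambda_def)

lemma polynomials_scaleC: "x \<in> polynomials \<Longrightarrow> scaleC_bop c x \<in> polynomials"
  by (erule polynomials_E) (auto simp: scaleC_bop_sum scaleC_bop_scaleC intro!: polynomials_sum polynomials_scaleC_lambda)

lemma polynomials_mult: "x \<in> polynomials \<Longrightarrow> y \<in> polynomials \<Longrightarrow> x * y \<in> polynomials"
  by (elim polynomials_E)
    (auto simp: sum_product scaleC_bop_mult_left scaleC_bop_mult_right scaleC_bop_scaleC lambda_mult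
      intro!: polynomials_sum polynomials_scaleC_lambda)

lemma polynomials_adjoint:
  assumes "x \<in> polynomials" shows "\<exists>y\<in>polynomials. is_adjoint x y"
proof -
  obtain f where f: "x = (\<Sum>g\<in>supp f. scaleC_bop (f g) (lambda \<sigma> g))" using assms by (rule polynomials_E)
  have "is_adjoint x (\<Sum>g\<in>supp f. scaleC_bop (cnj (f g)) (lambda_inv g))"
    unfolding f by (intro is_adjoint_sum is_adjoint_scaleC is_adjoint_lambda)
  moreover have "(\<Sum>g\<in>supp f. scaleC_bop (cnj (f g)) (lambda_inv g)) \<in> polynomials"
    by (auto simp: lambda_inv_def scaleC_bop_scaleC intro!: polynomials_sum polynomials_scaleC_lambda)
  ultimately show ?thesis by blast
qed

text \<open>Taking adjoints is isometric, so adjoints of a convergent sequence converge as well. This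
  produces adjoints without the Riesz representation theorem.\<close>

lemma closure_polynomials_adjoint:
  assumes "x \<in> closure polynomials" shows "\<exists>y\<in>closure polynomials. is_adjoint x y"
proof -
  obtain X where X: "\<And>n. X n \<in> polynomials" "X \<longlonglongrightarrow> x"
    using assms by (auto simp: closure_sequential)
  obtain Y where Y: "\<And>n. Y n \<in> polynomials" "\<And>n. is_adjoint (X n) (Y n)"
    using polynomials_adjoint[OF X(1)] by metis
  have iso: "norm (Y m - Y n) = norm (X m - X n)" for m n
    by (intro is_adjoint_norm is_adjoint_diff Y)
  have "Cauchy Y"
    using LIMSEQ_imp_Cauchy[OF X(2)] unfolding Cauchy_def dist_norm iso .
  then obtain y where y: "Y \<longlonglongrightarrow> y" by (auto simp: Cauchy_convergent_iff convergent_def)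
  then have "y \<in> closure polynomials" using Y by (auto simp: closure_sequential)
  with is_adjoint_LIMSEQ[OF X(2) y Y(2)] show ?thesis by blast
qed

lemma cstar_subalgebra_closure_polynomials: "cstar_subalgebra (closure polynomials)"
  unfolding cstar_subalgebra_def
proof (intro conjI ballI allI impI)
  show "0 \<in> closure polynomials" using polynomials_zero closure_subset by blast
  fix x assume x: "x \<in> closure polynomials"
  then obtain X where X: "\<And>n. X n \<in> polynomials" "X \<longlonglongrightarrow> x" by (auto simp: closure_sequential)
  show "scaleC_bop c x \<in> closure polynomials" for c
    unfolding closure_sequential using X polynomials_scaleC tendsto_scaleC_bop[OF X(2)]
    by (intro exI[of _ "\<lambda>n. scaleC_bop c (X n)"]) auto
  show "y \<in> closure polynomials" if "is_adjoint x y" for y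
    using closure_polynomials_adjoint[OF x] is_adjoint_unique[OF that] by blast
  fix y assume "y \<in> closure polynomials"
  then obtain Y where Y: "\<And>n. Y n \<in> polynomials" "Y \<longlonglongrightarrow> y" by (auto simp: closure_sequential)
  show "x + y \<in> closure polynomials"
    unfolding closure_sequential using X Y by (intro exI[of _ "\<lambda>n. X n + Y n"]) (auto intro: polynomials_add tendsto_add)
  show "x * y \<in> closure polynomials"
    unfolding closure_sequential using X Y by (intro exI[of _ "\<lambda>n. X n * Y n"]) (auto intro: polynomials_mult tendsto_mult)
qed simp

lemma lambda_in_reduced_cstar: "lambda \<sigma> g \<in> reduced_cstar \<sigma>"
  by (auto simp: reduced_cstar_def cstar_generated_def)

lemma reduced_cstar_subset: "reduced_cstar \<sigma> \<subseteq> closure polynomials"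
proof -
  have "range (lambda \<sigma>) \<subseteq> closure polynomials"
    using polynomials_scaleC_lambda[of 1] closure_subset by (auto simp: scaleC_bop_one)
  then show ?thesis
    using cstar_subalgebra_closure_polynomials by (auto simp: reduced_cstar_def cstar_generated_def)
qed

sublocale reduced: unital_cstar_algebra "reduced_cstar \<sigma>"
proof
  show "cstar_subalgebra (reduced_cstar \<sigma>)"
    unfolding reduced_cstar_def by (rule cstar_subalgebra_generated)
  show "1 \<in> reduced_cstar \<sigma>" using lambda_in_reduced_cstar[of 0] by (simp add: lambda_zero)
  show "\<exists>b. is_adjoint a b" if "a \<in> reduced_cstar \<sigma>" for a
    using that reduced_cstar_subset closure_polynomials_adjoint by blast
qed

lemma Lambda_in_reduced_cstar: "Lambda \<sigma> f \<in> reduced_cstar \<sigma>"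
  unfolding Lambda_def by (intro reduced.sum_closed reduced.scaleC_closed lambda_in_reduced_cstar)

lemma Rep_Lambda: "Rep_ell2 (Lambda \<sigma> f \<cdot> \<xi>) h = (\<Sum>g\<in>supp f. f g * (\<sigma> g (- g + h) * Rep_ell2 \<xi> (- g + h)))"
  by (simp add: Lambda_def bop_apply_sum Rep_ell2_sum scaleC_ell2.rep_eq Rep_lambda)

lemma Rep_Lambda_delta:
  assumes "finite (supp f)"
  shows "Rep_ell2 (Lambda \<sigma> f \<cdot> delta g) h = f (h - g) * \<sigma> (h - g) g"
proof -
  have "- k + h = g \<longleftrightarrow> k = h - g" for k
  proof
    assume "- k + h = g"
    then have "h = k + g" by (metis add_minus_cancel)
    then show "k = h - g" by simp
  next
    assume "k = h - g"
    then have "h = k + g" by simp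
    then show "- k + h = g" by simp
  qed
  then have "Rep_ell2 (Lambda \<sigma> f \<cdot> delta g) h = (\<Sum>k\<in>supp f. if k = h - g then f (h - g) * \<sigma> (h - g) g else 0)"
    unfolding Rep_Lambda delta.rep_eq by (intro sum.cong) auto
  also have "\<dots> = f (h - g) * \<sigma> (h - g) g"
    using assms by (auto simp: supp_def)
  finally show ?thesis .
qed

lemma norm_Lambda_delta:
  assumes "finite (supp f)" shows "norm (Lambda \<sigma> f \<cdot> delta 0) = norm2 f"
proof -
  have "norm (Lambda \<sigma> f \<cdot> delta 0) = sqrt (\<Sum>\<^sub>\<infinity>x. (cmod (f x))\<^sup>2)"
    by (simp add: norm_ell2.rep_eq Rep_Lambda_delta[OF assms])
  also have "(\<Sum>\<^sub>\<infinity>x. (cmod (f x))\<^sup>2) = (\<Sum>\<^sub>\<infinity>x\<in>supp f. (cmod (f x))\<^sup>2)"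
    by (rule infsum_cong_neutral) (auto simp: supp_def)
  also have "\<dots> = (\<Sum>x\<in>supp f. (cmod (f x))\<^sup>2)" using assms by simp
  finally show ?thesis by (simp add: norm2_def L2_set_def)
qed

text \<open>Elements of the algebra commute with the (twisted) right translations; this is that fact in
  terms of matrix coefficients. It makes \<open>\<delta>\<^sub>e\<close> a separating trace vector.\<close>

lemma matrix_coefficient:
  assumes "x \<in> reduced_cstar \<sigma>"
  shows "Rep_ell2 (x \<cdot> delta g) h = Rep_ell2 (x \<cdot> delta 0) (h - g) * \<sigma> (h - g) g"
proof -
  have "x \<in> closure polynomials" using assms reduced_cstar_subset by blast
  then obtain X where X: "\<And>n. X n \<in> polynomials" "X \<longlonglongrightarrow> x"
    by (auto simp: closure_sequential)
  have lim: "(\<lambda>n. Rep_ell2 (X n \<cdot> \<xi>) k) \<longlonglongrightarrow> Rep_ell2 (x \<cdot> \<xi>) k" for \<xi> k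
  proof (rule LIM_zero_cancel, rule Lim_null_comparison)
    show "\<forall>\<^sub>F n in sequentially. norm (Rep_ell2 (X n \<cdot> \<xi>) k - Rep_ell2 (x \<cdot> \<xi>) k) \<le> norm (X n \<cdot> \<xi> - x \<cdot> \<xi>)"
      using norm_Rep_le[of "X n \<cdot> \<xi> - x \<cdot> \<xi>" k for n] by (simp add: Rep_ell2_diff)
    show "(\<lambda>n. norm (X n \<cdot> \<xi> - x \<cdot> \<xi>)) \<longlonglongrightarrow> 0"
      using tendsto_bop_apply[OF X(2)] by (intro tendsto_norm_zero LIM_zero)
  qed
  have "Rep_ell2 (X n \<cdot> delta g) h = Rep_ell2 (X n \<cdot> delta 0) (h - g) * \<sigma> (h - g) g" for n
    using X(1)[of n] by (auto simp: polynomials_def Cc_def Rep_Lambda_delta)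
  then show ?thesis
    using lim[of "delta g" h] tendsto_mult_right[OF lim[of "delta 0" "h - g"], of "\<sigma> (h - g) g"]
    by (simp add: LIMSEQ_unique)
qed

text \<open>If \<open>x\<delta>\<^sub>e = 0\<close>, then \<open>x\<close> vanishes on the whole basis, which says that all coordinates of all
  vectors \<open>x\<^sup>*\<eta>\<close> vanish. The trace property holds since \<open>\<bar>(x\<^sup>*\<delta>\<^sub>e)(g)\<bar> = \<bar>(x\<delta>\<^sub>g)(e)\<bar> = \<bar>(x\<delta>\<^sub>e)(g\<^sup>-\<^sup>1)\<bar>\<close>.\<close>

sublocale reduced: tracial_cstar_algebra "reduced_cstar \<sigma>" "delta 0"
proof
  show "norm (delta (0::'g)) = 1" by (rule norm_delta)
next
  fix x assume x: "x \<in> reduced_cstar \<sigma>" "x \<cdot> delta 0 = 0"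
  obtain x' where x': "is_adjoint x x'" using reduced.adjoint_exists[OF x(1)] by auto
  have "Rep_ell2 (x' \<cdot> \<eta>) g = 0" for \<eta> g
  proof -
    have "x \<cdot> delta g = 0"
      using matrix_coefficient[OF x(1)] x(2) by (intro ell2_eqI) (simp add: zero_ell2.rep_eq)
    then have "cinner \<eta> (x \<cdot> delta g) = 0" by (simp add: cinner_def zero_ell2.rep_eq)
    then show ?thesis
      using is_adjoint_sym[OF x'] by (simp add: is_adjoint_def cinner_delta[symmetric])
  qed
  then have "x' = 0" by (intro bop_eqI ell2_eqI) (simp add: zero_ell2.rep_eq)
  then show "x = 0" using is_adjoint_norm[OF x'] by simp
next
  fix x x' assume x: "x \<in> reduced_cstar \<sigma>" "is_adjoint x x'"
  have "cmod (Rep_ell2 (x' \<cdot> delta 0) g) = cmod (Rep_ell2 (x \<cdot> delta 0) (- g))" for g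
  proof -
    have "Rep_ell2 (x' \<cdot> delta 0) g = cinner (delta 0) (x \<cdot> delta g)"
      using is_adjoint_sym[OF x(2)] by (simp add: is_adjoint_def cinner_delta[symmetric])
    also have "\<dots> = cnj (Rep_ell2 (x \<cdot> delta g) 0)"
      by (subst cinner_commute) (simp add: cinner_delta)
    finally show ?thesis by (simp add: matrix_coefficient[OF x(1), of g] norm_mult)
  qed
  moreover have "(\<Sum>\<^sub>\<infinity>g. (cmod (Rep_ell2 (x \<cdot> delta 0) (- g)))\<^sup>2) = (\<Sum>\<^sub>\<infinity>g. (cmod (Rep_ell2 (x \<cdot> delta 0) g))\<^sup>2)"
    by (rule infsum_reindex_bij_betw) (rule bij_betw_byWitness[of _ uminus], auto)
  ultimately show "norm (x' \<cdot> delta 0) = norm (x \<cdot> delta 0)"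
    by (simp add: norm_ell2.rep_eq)
qed

lemma lambda_mult_Lambda:
  assumes "finite (supp f)"
  shows "lambda \<sigma> g * Lambda \<sigma> f = Lambda \<sigma> (twisted_shift \<sigma> g f)"
    and "supp (twisted_shift \<sigma> g f) = (+) g ` supp f"
proof -
  show s: "supp (twisted_shift \<sigma> g f) = (+) g ` supp f"
    by (force simp: supp_def twisted_shift_def add.assoc[symmetric] image_iff intro: exI[of _ "- g + _"])
  have "Lambda \<sigma> (twisted_shift \<sigma> g f) = (\<Sum>h\<in>supp f. scaleC_bop (twisted_shift \<sigma> g f (g + h)) (lambda \<sigma> (g + h)))"
    unfolding Lambda_def s by (subst sum.reindex) (auto simp: inj_on_def)
  also have "\<dots> = lambda \<sigma> g * Lambda \<sigma> f"
    unfolding Lambda_def sum_distrib_left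
    by (intro sum.cong refl)
      (simp add: twisted_shift_def add.assoc[symmetric] scaleC_bop_mult_right lambda_mult scaleC_bop_scaleC mult.commute)
  finally show "lambda \<sigma> g * Lambda \<sigma> f = Lambda \<sigma> (twisted_shift \<sigma> g f)" ..
qed

text \<open>Translating the support of \<open>\<Lambda>(f)\<close> by \<open>g\<close> amounts to multiplying by a unitary, which does not
  change the distance to the invertible elements; the spectral radius of the translate bounds
  that distance.\<close>

lemma near_units_if_SR:
  assumes SR: "\<And>F::'g set. finite F \<Longrightarrow> \<exists>g. SR_property_wrt \<sigma> ((+) g ` F)"
    and b: "b \<in> reduced_cstar \<sigma>" and "\<eta> > 0"
  shows "\<exists>c\<in>reduced.units. norm (b - c) < norm (b \<cdot> delta 0) + \<eta>"
proof -
  have "\<eta> / 4 > 0" using \<open>\<eta> > 0\<close> by simp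
  then obtain x where x: "x \<in> polynomials" "dist x b < \<eta> / 4"
    using b reduced_cstar_subset by (metis closure_approachable subsetD)
  then obtain f where f: "x = Lambda \<sigma> f" "finite (supp f)" by (auto simp: polynomials_def Cc_def)
  obtain g where g: "SR_property_wrt \<sigma> ((+) g ` supp f)" using SR[OF f(2)] by auto
  define f' where "f' = twisted_shift \<sigma> g f"
  have f': "supp f' = (+) g ` supp f" "Lambda \<sigma> f' = lambda \<sigma> g * x"
    using lambda_mult_Lambda[OF f(2)] by (simp_all add: f'_def f(1))
  then have fin: "finite (supp f')" using f(2) by simp
  have "norm2 f' = norm (x \<cdot> delta 0)"
    using norm_Lambda_delta[OF fin] by (simp add: f' norm_lambda_apply)
  moreover have "norm (x \<cdot> delta 0) \<le> norm (b \<cdot> delta 0) + \<eta> / 4"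
  proof -
    have "norm (x \<cdot> delta 0 - b \<cdot> delta 0) \<le> \<eta> / 4"
      using norm_bop_apply_le[of "x - b" "delta 0"] x(2) by (simp add: dist_norm norm_delta)
    then show ?thesis using norm_triangle_ineq2[of "x \<cdot> delta 0" "b \<cdot> delta 0"] by linarith
  qed
  moreover have "spectral_radius (Lambda \<sigma> f') \<le> norm2 f'"
    using g f'(1) fin unfolding SR_property_wrt_def Cc_def by auto
  ultimately have "spectral_radius (Lambda \<sigma> f') \<le> norm (b \<cdot> delta 0) + \<eta> / 4"
    by linarith
  moreover define z where "z = norm (b \<cdot> delta 0) + \<eta> / 2"
  ultimately have "spectral_radius (Lambda \<sigma> f') < z" "0 < z"
    using \<open>\<eta> > 0\<close> by (simp_all add: add_nonneg_pos)
  then have "complex_of_real z \<notin> spectrum (Lambda \<sigma> f')"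
    by (intro not_in_spectrum_if_gt_spectral_radius) simp
  then have "scaleC_bop (complex_of_real z) 1 - Lambda \<sigma> f' \<in> reduced.units"
    by (intro reduced.invertible_in_units reduced.diff_closed reduced.scaleC_closed reduced.one_closed
        Lambda_in_reduced_cstar) (simp add: spectrum_def)
  then have "- 1 *\<^sub>R (scaleC_bop (complex_of_real z) 1 - Lambda \<sigma> f') \<in> reduced.units"
    by (rule reduced.units_scaleR) simp
  then have unit: "lambda \<sigma> g * x - z *\<^sub>R 1 \<in> reduced.units"
    by (simp add: f' scaleR_bop_scaleC[symmetric])
  have inv: "lambda_inv g \<in> reduced.units"
    using lambda_inv_lambda lambda_lambda_inv reduced.adjoint_closed[OF lambda_in_reduced_cstar is_adjoint_lambda]
    by (intro reduced.units_I[of _ "lambda \<sigma> g"] lambda_in_reduced_cstar)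
  define c where "c = lambda_inv g * (lambda \<sigma> g * x - z *\<^sub>R 1)"
  have "c \<in> reduced.units" unfolding c_def using inv unit by (rule reduced.units_mult)
  have "c = (lambda_inv g * lambda \<sigma> g) * x - z *\<^sub>R lambda_inv g"
    by (simp add: c_def right_diff_distrib mult.assoc)
  then have "x - c = z *\<^sub>R lambda_inv g" by (simp add: lambda_inv_lambda)
  moreover have "norm (lambda_inv g) \<le> 1"
    using is_adjoint_norm[OF is_adjoint_lambda[of g]] norm_bop_le[of 1 "lambda \<sigma> g"] by (simp add: norm_lambda_apply)
  ultimately have "norm (x - c) \<le> z" using \<open>0 < z\<close> by simp
  then have "norm (b - c) < norm (b \<cdot> delta 0) + \<eta>"
    using x(2) norm_triangle_ineq[of "b - x" "x - c"] \<open>\<eta> > 0\<close>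
    by (simp add: z_def dist_norm norm_minus_commute)
  with \<open>c \<in> reduced.units\<close> show ?thesis by blast
qed

theorem stable_rank_one_if_SR:
  assumes "\<And>F::'g set. finite F \<Longrightarrow> \<exists>g. SR_property_wrt \<sigma> ((+) g ` F)"
  shows "stable_rank_one (reduced_cstar \<sigma>)"
  by (rule reduced.stable_rank_one_if_near_units) (rule near_units_if_SR[OF assms])

end

section \<open>Spectral radius estimates\<close>

text \<open>Besides the pointwise bound, \<open>\<eta>\<close> is required to be nonnegative, which is what makes the relation
  stable under operators with nonnegative coefficients.\<close>

definition dominated :: "'g ell2 \<Rightarrow> 'g ell2 \<Rightarrow> bool" where
  "dominated \<xi> \<eta> \<longleftrightarrow> (\<exists>r. \<forall>x. Rep_ell2 \<eta> x = complex_of_real (r x) \<and> cmod (Rep_ell2 \<xi> x) \<le> r x)"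

lemma dominated_norm_le:
  assumes "dominated \<xi> \<eta>" shows "norm \<xi> \<le> norm \<eta>"
proof -
  have "cmod (Rep_ell2 \<xi> x) \<le> cmod (Rep_ell2 \<eta> x)" for x
    using assms norm_ge_zero unfolding dominated_def by (metis abs_of_nonneg norm_of_real order_trans)
  then show ?thesis
    using square_summable_Rep[of \<xi>] square_summable_Rep[of \<eta>]
    unfolding norm_ell2.rep_eq square_summable_def by (intro real_sqrt_le_mono infsum_mono power_mono) auto
qed

lift_definition modulus :: "'g ell2 \<Rightarrow> 'g ell2" is "\<lambda>f x. complex_of_real (cmod (f x))"
  by (simp add: square_summable_def)

lemma norm_modulus: "norm (modulus \<xi>) = norm \<xi>"
  by transfer simp

lemma twisted_group_trivial: "twisted_group trivial_cocycle"
  by unfold_locales (simp add: normalized_cocycle_def)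

context twisted_group
begin

text \<open>The triangle inequality, iterated; the cocycle disappears because its values have modulus one.\<close>

lemma dominated_Lambda_power:
  "dominated ((Lambda \<sigma> f ^ n) \<cdot> \<xi>) ((Lambda trivial_cocycle (\<lambda>g. of_real (cmod (f g))) ^ n) \<cdot> modulus \<xi>)"
proof (induction n)
  case 0
  then show ?case by (auto simp: dominated_def modulus.rep_eq)
next
  case (Suc n)
  let ?F = "\<lambda>g. complex_of_real (cmod (f g))"
  have supp: "supp ?F = supp f" by (simp add: supp_def)
  obtain r where r: "\<And>x. Rep_ell2 ((Lambda trivial_cocycle ?F ^ n) \<cdot> modulus \<xi>) x = complex_of_real (r x)"
    "\<And>x. cmod (Rep_ell2 ((Lambda \<sigma> f ^ n) \<cdot> \<xi>) x) \<le> r x"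
    using Suc unfolding dominated_def by blast
  let ?r = "\<lambda>x. \<Sum>g\<in>supp f. cmod (f g) * r (- g + x)"
  have "Rep_ell2 ((Lambda trivial_cocycle ?F ^ Suc n) \<cdot> modulus \<xi>) x = complex_of_real (?r x)" for x
    by (simp add: twisted_group.Rep_Lambda[OF twisted_group_trivial] supp r)
  moreover have "cmod (Rep_ell2 ((Lambda \<sigma> f ^ Suc n) \<cdot> \<xi>) x) \<le> ?r x" for x
    by (auto simp: Rep_Lambda norm_mult intro!: sum_norm_le mult_left_mono r)
  ultimately show ?case unfolding dominated_def by (intro exI[of _ ?r]) simp
qed

lemma norm_Lambda_power_le:
  "norm (Lambda \<sigma> f ^ n) \<le> norm (Lambda trivial_cocycle (\<lambda>g. of_real (cmod (f g))) ^ n)"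
proof (rule norm_bop_le)
  fix \<xi>
  let ?b = "Lambda trivial_cocycle (\<lambda>g. of_real (cmod (f g))) ^ n"
  have "norm ((Lambda \<sigma> f ^ n) \<cdot> \<xi>) \<le> norm (?b \<cdot> modulus \<xi>)"
    by (rule dominated_norm_le[OF dominated_Lambda_power])
  also have "\<dots> \<le> norm ?b * norm (modulus \<xi>)" by (rule norm_bop_apply_le)
  also have "\<dots> = norm ?b * norm \<xi>" by (simp only: norm_modulus)
  finally show "norm ((Lambda \<sigma> f ^ n) \<cdot> \<xi>) \<le> norm ?b * norm \<xi>" .
qed simp

lemma SR_property_wrt_if_SR_property:
  assumes "SR_property S" shows "SR_property_wrt \<sigma> S"
  unfolding SR_property_wrt_def
proof (intro conjI ballI impI)
  show "finite S" using assms by (simp add: SR_property_wrt_def)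
  fix f :: "'g \<Rightarrow> complex" assume f: "f \<in> Cc" "supp f \<subseteq> S"
  let ?F = "\<lambda>g. complex_of_real (cmod (f g))"
  have supp: "supp ?F = supp f" by (simp add: supp_def)
  have "?F \<in> Cc" using f supp by (simp add: Cc_def)
  moreover have "supp ?F \<subseteq> S" using f supp by simp
  ultimately have "spectral_radius (Lambda trivial_cocycle ?F) \<le> norm2 ?F"
    using assms unfolding SR_property_wrt_def by blast
  also have "norm2 ?F = norm2 f" by (simp add: norm2_def supp)
  finally have "spectral_radius (Lambda trivial_cocycle ?F) \<le> norm2 f" .
  then show "spectral_radius (Lambda \<sigma> f) \<le> norm2 f"
    by (rule spectral_radius_le_if_powers_le[OF norm_Lambda_power_le])
qed

text \<open>The translates \<open>g W\<close> for \<open>g\<close> in the support of \<open>f\<close> are disjoint, so the summands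
  \<open>f(g) \<lambda>\<^sub>\<sigma>(g) \<xi>\<close> are orthogonal.\<close>

lemma norm_Lambda_apply_orthogonal:
  assumes fin: "finite (supp f)" and W: "\<And>x. Rep_ell2 \<xi> x \<noteq> 0 \<Longrightarrow> x \<in> W"
    and inj: "\<And>g g' x x'. g \<in> supp f \<Longrightarrow> g' \<in> supp f \<Longrightarrow> x \<in> W \<Longrightarrow> x' \<in> W \<Longrightarrow> g + x = g' + x' \<Longrightarrow> g = g'"
  shows "norm (Lambda \<sigma> f \<cdot> \<xi>) = norm2 f * norm \<xi>"
proof -
  let ?t = "\<lambda>g. scaleC_ell2 (f g) (lambda \<sigma> g \<cdot> \<xi>)"
  have "orthogonal (?t g) (?t g')" if g: "g \<in> supp f" "g' \<in> supp f" "g \<noteq> g'" for g g'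
  proof -
    have zero: "Rep_ell2 (?t g) x * cnj (Rep_ell2 (?t g') x) = 0" for x
    proof (rule ccontr)
      assume "Rep_ell2 (?t g) x * cnj (Rep_ell2 (?t g') x) \<noteq> 0"
      then have "- g + x \<in> W" "- g' + x \<in> W"
        by (auto simp: scaleC_ell2.rep_eq Rep_lambda intro: W)
      from inj[OF g(1,2) this] have "g = g'" by simp
      with g(3) show False by simp
    qed
    show ?thesis unfolding orthogonal_def inner_ell2_def cinner_def zero by simp
  qed
  then have "(norm (\<Sum>g\<in>supp f. ?t g))\<^sup>2 = (\<Sum>g\<in>supp f. (norm (?t g))\<^sup>2)"
    by (intro norm_sum_Pythagorean[OF fin]) (auto simp: pairwise_def)
  also have "(\<Sum>g\<in>supp f. ?t g) = Lambda \<sigma> f \<cdot> \<xi>"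
    by (simp add: Lambda_def bop_apply_sum)
  also have "(\<Sum>g\<in>supp f. (norm (?t g))\<^sup>2) = (norm2 f * norm \<xi>)\<^sup>2"
    by (simp add: norm_scaleC_ell2 norm_lambda_apply power_mult_distrib sum_distrib_right[symmetric]
        norm2_def L2_set_def sum_nonneg)
  finally show ?thesis
    by (rule power2_eq_imp_eq) (simp_all add: norm2_def)
qed

text \<open>Over a semifree set, distinct words have distinct values, so that \<open>f\<close> never cancels in its
  convolution powers.\<close>

lemma norm_Lambda_power_semifree:
  assumes S: "semifree S" and f: "supp f \<subseteq> S"
  shows "norm ((Lambda \<sigma> f ^ n) \<cdot> delta 0) = norm2 f ^ n"
proof -
  have inj: "inj_on sum_list (lists S - {[]})" and fin: "finite (supp f)"
    using S f by (auto simp: semifree_def bij_betw_def intro: finite_subset)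
  define W where "W n = sum_list ` {w \<in> lists S. length w = n}" for n
  have "(\<forall>x. Rep_ell2 ((Lambda \<sigma> f ^ n) \<cdot> delta 0) x \<noteq> 0 \<longrightarrow> x \<in> W n) \<and>
    norm ((Lambda \<sigma> f ^ n) \<cdot> delta 0) = norm2 f ^ n"
  proof (induction n)
    case 0
    then show ?case by (auto simp: delta.rep_eq W_def norm_delta split: if_splits)
  next
    case (Suc n)
    let ?\<xi> = "(Lambda \<sigma> f ^ n) \<cdot> delta 0"
    have "x \<in> W (Suc n)" if "Rep_ell2 (Lambda \<sigma> f \<cdot> ?\<xi>) x \<noteq> 0" for x
    proof -
      have "\<exists>g\<in>supp f. Rep_ell2 ?\<xi> (- g + x) \<noteq> 0"
      proof (rule ccontr)
        assume "\<not> ?thesis"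
        then have "Rep_ell2 (Lambda \<sigma> f \<cdot> ?\<xi>) x = 0" unfolding Rep_Lambda by simp
        with that show False by simp
      qed
      then obtain g where g: "g \<in> supp f" "Rep_ell2 ?\<xi> (- g + x) \<noteq> 0" by blast
      then obtain w where w: "w \<in> lists S" "length w = n" "- g + x = sum_list w"
        using Suc by (auto simp: W_def)
      then have "x = sum_list (g # w)" by (metis add_minus_cancel sum_list.Cons)
      moreover have "g # w \<in> {w \<in> lists S. length w = Suc n}" using w g f by auto
      ultimately show ?thesis unfolding W_def by (rule image_eqI)
    qed
    moreover have "norm (Lambda \<sigma> f \<cdot> ?\<xi>) = norm2 f * norm ?\<xi>"
    proof (rule norm_Lambda_apply_orthogonal[OF fin, where W = "W n"])
      fix g g' x x' assume g: "g \<in> supp f" "g' \<in> supp f" and "x \<in> W n" "x' \<in> W n" and eq: "g + x = g' + x'"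
      then obtain w w' where w: "w \<in> lists S" "x = sum_list w" "w' \<in> lists S" "x' = sum_list w'"
        by (auto simp: W_def)
      then have "sum_list (g # w) = sum_list (g' # w')" using eq by simp
      then have "g # w = g' # w'" using g w f by (intro inj_onD[OF inj]) auto
      then show "g = g'" by simp
    qed (use Suc in blast)
    ultimately show ?case using Suc by simp
  qed
  then show ?thesis by blast
qed

end

lemma SR_property_if_semifree:
  assumes "semifree S" "l2_spectral_radius_property S"
  shows "SR_property S"
  unfolding SR_property_wrt_def
proof (intro conjI ballI impI)
  show "finite S" using assms by (simp add: semifree_def)
  fix f :: "'a \<Rightarrow> complex" assume f: "f \<in> Cc" "supp f \<subseteq> S"
  let ?a = "Lambda trivial_cocycle f"
  have "0 \<le> norm2 f" by (simp add: norm2_def)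
  then have "root n (norm ((?a ^ n) \<cdot> delta 0)) = norm2 f" if "n > 0" for n
    using twisted_group.norm_Lambda_power_semifree[OF twisted_group_trivial assms(1) f(2), of n] that
    by (simp add: real_root_power_cancel)
  then have "(\<lambda>n. ereal (root n (norm ((?a ^ n) \<cdot> delta 0)))) \<longlonglongrightarrow> ereal (norm2 f)"
    by (intro tendsto_eventually eventually_sequentiallyI[of 1]) simp
  then have "r2 ?a = ereal (norm2 f)"
    unfolding r2_def by (intro lim_imp_Limsup) simp_all
  then show "spectral_radius ?a \<le> norm2 f"
    using assms(2) f by (auto simp: l2_spectral_radius_property_def)
qed

theorem theoremA1:
  fixes \<sigma> :: "'g::group_add \<Rightarrow> 'g \<Rightarrow> complex"
  assumes "normalized_cocycle \<sigma>"
  shows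
    "(l2_spectral_radius_group TYPE('g) \<and> free_semigroup_property TYPE('g) \<longrightarrow>
       (\<forall>F::'g set. finite F \<longrightarrow>
          (\<exists>g. semifree ((+) g ` F) \<and> l2_spectral_radius_property ((+) g ` F)))) \<and>
     ((\<forall>F::'g set. finite F \<longrightarrow>
          (\<exists>g. semifree ((+) g ` F) \<and> l2_spectral_radius_property ((+) g ` F))) \<longrightarrow>
       (\<forall>F::'g set. finite F \<longrightarrow> (\<exists>g. SR_property ((+) g ` F)))) \<and>
     ((\<forall>F::'g set. finite F \<longrightarrow> (\<exists>g. SR_property ((+) g ` F))) \<longrightarrow>
       (\<forall>F::'g set. finite F \<longrightarrow> (\<exists>g. SR_property_wrt \<sigma> ((+) g ` F)))) \<and>
     ((\<forall>F::'g set. finite F \<longrightarrow> (\<exists>g. SR_property_wrt \<sigma> ((+) g ` F))) \<longrightarrow>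
       stable_rank_one (reduced_cstar \<sigma>))"
proof -
  interpret twisted_group \<sigma> using assms by unfold_locales
  show ?thesis
  proof (intro conjI impI)
    assume "l2_spectral_radius_group TYPE('g) \<and> free_semigroup_property TYPE('g)"
    then show "\<forall>F::'g set. finite F \<longrightarrow>
        (\<exists>g. semifree ((+) g ` F) \<and> l2_spectral_radius_property ((+) g ` F))"
      unfolding l2_spectral_radius_group_def free_semigroup_property_def by (metis finite_imageI)
  next
    assume "\<forall>F::'g set. finite F \<longrightarrow>
        (\<exists>g. semifree ((+) g ` F) \<and> l2_spectral_radius_property ((+) g ` F))"
    then show "\<forall>F::'g set. finite F \<longrightarrow> (\<exists>g. SR_property ((+) g ` F))"
      using SR_property_if_semifree by metis
  next
    assume "\<forall>F::'g set. finite F \<longrightarrow> (\<exists>g. SR_property ((+) g ` F))"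
    then show "\<forall>F::'g set. finite F \<longrightarrow> (\<exists>g. SR_property_wrt \<sigma> ((+) g ` F))"
      using SR_property_wrt_if_SR_property by metis
  next
    assume "\<forall>F::'g set. finite F \<longrightarrow> (\<exists>g. SR_property_wrt \<sigma> ((+) g ` F))"
    then show "stable_rank_one (reduced_cstar \<sigma>)"
      by (intro stable_rank_one_if_SR) blast
  qed
qed

end
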